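(* Let $R$ be the strong ring. (1) Every additive prime of $R$ (i.e. the class in $R$ of any non-empty connected product complex) is a product of multiplicative primes of $R$, and this factorization is unique up to the order of the factors and up to signs of the factors (with $K_1$ being the empty product). (2) The class in $R$ of a non-empty connected product complex not isomorphic to $K_1$ is a multiplicative prime of $R$ if and only if it is the class of a connected finite abstract simplicial complex.
   Context: A finite abstract simplicial complex is a finite set of finite non-empty sets which is closed under taking non-empty subsets. A product complex is a finite Cartesian product $G_1\times\cdots\times G_n$ ($n\ge 1$) of finite abstract simplicial complexes; its cells are the sets $x=x_1\times\cdots\times x_n$ with $x_i\in G_i$, ordered by inclusion. Two product complexes are isomorphic if there is a bijection between their cells preserving inclusion in both directions. A product complex is connected if the graph with the cells as vertices, in which two cells are adjacent when they intersect, is connected. A signed complex is a finite formal disjoint union of product complexes, each summand carrying a sign in $\{1,-1\}$. Addition is disjoint union, $-G$ reverses all signs, and products are taken term by term with signs multiplied. The strong ring $R$ is the commutative ring of signed complexes modulo isomorphism of summands, splitting of summands into their connected components (with the same sign), and cancellation of $G\oplus(-G)$. Its zero is the empty complex and its one is the one-point complex $K_1$. As an additive group $R$ is free abelian on the isomorphism classes of non-empty connected product complexes. A multiplicative prime of $R$ is an element different from $0$ and $\pm K_1$ that cannot be written as a product $G_1\times G_2$ with both $G_1,G_2\in R$ different from $\pm K_1$. *)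

theory Defs
  imports "HOL-Library.Multiset" "HOL-Library.Infinite_Typeclass"
begin

section \<open>Product complexes\<close>

definition is_simplicial_complex :: "'v set set \<Rightarrow> bool" where
  "is_simplicial_complex S \<longleftrightarrow>
     finite S \<and> (\<forall>x\<in>S. finite x \<and> x \<noteq> {}) \<and> (\<forall>x\<in>S. \<forall>y. y \<subseteq> x \<and> y \<noteq> {} \<longrightarrow> y \<in> S)"

typedef 'v simplicial_complex = "{S :: 'v set set. is_simplicial_complex S}"
  morphisms simplices Simplicial_complex
proof
  show "{} \<in> {S :: 'v set set. is_simplicial_complex S}"
    by (simp add: is_simplicial_complex_def)
qed

typedef 'v product_complex = "{Gs :: 'v simplicial_complex list. Gs \<noteq> []}"
  morphisms factors Product_complex
proof
  show "[undefined] \<in> {Gs :: 'v simplicial_complex list. Gs \<noteq> []}"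
    by simp
qed

text \<open>
  A cell is the Cartesian product of one simplex per factor. It is a set of lists of vertices,
  as \<open>listset [x1, \<dots>, xn]\<close> is the set of all lists \<open>[v1, \<dots>, vn]\<close> with \<open>vi \<in> xi\<close>. The inner
  \<open>listset\<close> below ranges over the choices of simplices, the outer one forms their product.
\<close>

definition cells :: "'v product_complex \<Rightarrow> 'v list set set" where
  "cells G = listset ` listset (map simplices (factors G))"

definition complex_iso :: "'v product_complex \<Rightarrow> 'v product_complex \<Rightarrow> bool" where
  "complex_iso G H \<longleftrightarrow> (\<exists>f. bij_betw f (cells G) (cells H) \<and>
     (\<forall>x\<in>cells G. \<forall>y\<in>cells G. f x \<subseteq> f y \<longleftrightarrow> x \<subseteq> y))"

definition intersecting :: "'v product_complex \<Rightarrow> ('v list set \<times> 'v list set) set" where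
  "intersecting G = {(x, y). x \<in> cells G \<and> y \<in> cells G \<and> x \<inter> y \<noteq> {}}"

definition connected_complex :: "'v product_complex \<Rightarrow> bool" where
  "connected_complex G \<longleftrightarrow> (\<forall>x\<in>cells G. \<forall>y\<in>cells G. (x, y) \<in> (intersecting G)\<^sup>*)"

definition conn_components :: "'v product_complex \<Rightarrow> 'v list set set set" where
  "conn_components G = cells G // (intersecting G)\<^sup>*"

definition of_simplicial_complex :: "'v simplicial_complex \<Rightarrow> 'v product_complex" where
  "of_simplicial_complex S = Product_complex [S]"

definition complex_times :: "'v product_complex \<Rightarrow> 'v product_complex \<Rightarrow> 'v product_complex" where
  "complex_times G H = Product_complex (factors G @ factors H)"

text \<open>All one-point complexes are isomorphic, so the choice of the vertex is immaterial.\<close>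

definition one_point :: "'v simplicial_complex" where
  "one_point = Simplicial_complex {{undefined}}"

definition K1 :: "'v product_complex" where
  "K1 = of_simplicial_complex one_point"


section \<open>Signed complexes\<close>

typedef sign = "{1, - 1 :: int}"
  morphisms int_of_sign Sign
  by auto

setup_lifting type_definition_sign

instantiation sign :: "{comm_monoid_mult, uminus}"
begin

lift_definition one_sign :: sign is 1 by simp
lift_definition times_sign :: "sign \<Rightarrow> sign \<Rightarrow> sign" is "(*)" by auto
lift_definition uminus_sign :: "sign \<Rightarrow> sign" is uminus by auto

instance
  by standard (transfer; simp add: ac_simps)+

end

type_synonym 'v signed_complex = "(sign \<times> 'v product_complex) multiset"

definition sc_uminus :: "'v signed_complex \<Rightarrow> 'v signed_complex" where
  "sc_uminus X = image_mset (\<lambda>(s, G). (- s, G)) X"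

definition sc_times :: "'v signed_complex \<Rightarrow> 'v signed_complex \<Rightarrow> 'v signed_complex" where
  "sc_times X Y = (\<Sum>(s, G)\<in>#X. image_mset (\<lambda>(t, H). (s * t, complex_times G H)) Y)"

text \<open>
  In \<open>split\<close>, the summands \<open>Hs\<close> are product complexes whose cell sets are exactly the connected
  components of the intersection graph of \<open>G\<close>, each occurring once. If \<open>G\<close> has no cells, then
  \<open>Hs\<close> is empty.
\<close>

inductive sc_equiv :: "'v signed_complex \<Rightarrow> 'v signed_complex \<Rightarrow> bool" where
  iso: "complex_iso G H \<Longrightarrow> sc_equiv {#(s, G)#} {#(s, H)#}"
| split: "image_mset cells Hs = mset_set (conn_components G) \<Longrightarrow>
    sc_equiv {#(s, G)#} (image_mset (Pair s) Hs)"
| cancel: "sc_equiv (X + sc_uminus X) {#}"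
| add: "sc_equiv X Y \<Longrightarrow> sc_equiv (X + Z) (Y + Z)"
| refl: "sc_equiv X X"
| sym: "sc_equiv X Y \<Longrightarrow> sc_equiv Y X"
| trans: "sc_equiv X Y \<Longrightarrow> sc_equiv Y Z \<Longrightarrow> sc_equiv X Z"

lemma equivp_sc_equiv: "equivp sc_equiv"
  by (intro equivpI reflpI sympI transpI) (auto intro: sc_equiv.intros)


section \<open>Cells of a product\<close>

definition cell_times :: "'v list set \<Rightarrow> 'v list set \<Rightarrow> 'v list set" where
  "cell_times x y = (\<lambda>(a, b). a @ b) ` (x \<times> y)"

lemma factors_nonempty: "factors G \<noteq> []"
  using factors[of G] by simp

lemma factors_simps [simp]:
  "factors (of_simplicial_complex S) = [S]"
  "factors (complex_times G H) = factors G @ factors H"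
  by (simp_all add: of_simplicial_complex_def complex_times_def Product_complex_inverse
      factors_nonempty)

lemma simplices_one_point: "simplices one_point = {{undefined}}"
  unfolding one_point_def
  by (rule Simplicial_complex_inverse) (auto simp: is_simplicial_complex_def)

definition dimension :: "'v product_complex \<Rightarrow> nat" where
  "dimension G = length (factors G)"

lemma listset_conv: "listset As = {xs. list_all2 (\<in>) xs As}"
  by (induction As) (auto simp: set_Cons_def list_all2_Cons2)

lemma listset_append: "listset (As @ Bs) = (\<lambda>(a, b). a @ b) ` (listset As \<times> listset Bs)"
proof (intro equalityI subsetI)
  fix xs assume "xs \<in> listset (As @ Bs)"
  then obtain a b where "xs = a @ b" "list_all2 (\<in>) a As" "list_all2 (\<in>) b Bs"
    unfolding listset_conv mem_Collect_eq list_all2_append2 by blast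
  then show "xs \<in> (\<lambda>(a, b). a @ b) ` (listset As \<times> listset Bs)"
    unfolding listset_conv by auto
qed (auto simp: listset_conv intro: list_all2_appendI)

lemma finite_listset: "(\<And>A. A \<in> set As \<Longrightarrow> finite A) \<Longrightarrow> finite (listset As)"
proof (induction As)
  case (Cons A As)
  have "set_Cons A (listset As) = (\<lambda>(x, xs). x # xs) ` (A \<times> listset As)"
    by (auto simp: set_Cons_def)
  with Cons show ?case by simp
qed simp

lemma listset_nonempty: "(\<And>A. A \<in> set As \<Longrightarrow> A \<noteq> {}) \<Longrightarrow> listset As \<noteq> {}"
proof (induction As)
  case (Cons A As)
  then have "\<exists>x. x \<in> A" "\<exists>xs. xs \<in> listset As" by auto
  then show ?case by (auto simp: set_Cons_def)
qed simp

lemma simplices_props: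
  "finite (simplices S)" "x \<in> simplices S \<Longrightarrow> x \<noteq> {}"
  "x \<in> simplices S \<Longrightarrow> y \<subseteq> x \<Longrightarrow> y \<noteq> {} \<Longrightarrow> y \<in> simplices S"
  "x \<in> simplices S \<Longrightarrow> finite x"
  using simplices[of S] unfolding mem_Collect_eq is_simplicial_complex_def by blast+

lemma finite_cells [simp]: "finite (cells G)"
  unfolding cells_def by (intro finite_imageI finite_listset) (auto simp: simplices_props(1))

lemma cell_nonempty: "x \<in> cells G \<Longrightarrow> x \<noteq> {}"
proof -
  assume "x \<in> cells G"
  then obtain xs where xs: "list_all2 (\<in>) xs (map simplices (factors G))" "x = listset xs"
    by (auto simp: cells_def listset_conv[of "map simplices (factors G)"])
  have "A \<noteq> {}" if "A \<in> set xs" for A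
    using that xs(1) by (metis in_set_conv_nth length_map list_all2_conv_all_nth nth_map simplices_props(2))
  then show "x \<noteq> {}" using xs(2) listset_nonempty by metis
qed

lemma cell_length: "x \<in> cells G \<Longrightarrow> a \<in> x \<Longrightarrow> length a = dimension G"
  by (auto simp: cells_def listset_conv dimension_def dest!: list_all2_lengthD)

lemma cells_times:
  "cells (complex_times G H) = (\<lambda>(x, y). cell_times x y) ` (cells G \<times> cells H)"
proof -
  have "cells (complex_times G H) = listset ` (\<lambda>(a, b). a @ b) `
      (listset (map simplices (factors G)) \<times> listset (map simplices (factors H)))"
    by (simp add: cells_def listset_append)
  also have "\<dots> = (\<lambda>(x, y). cell_times x y) ` (\<lambda>(a, b). (listset a, listset b)) `
      (listset (map simplices (factors G)) \<times> listset (map simplices (factors H)))"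
    by (simp add: image_image split_def listset_append cell_times_def)
  finally show ?thesis
    unfolding image_paired_Times cells_def[symmetric] .
qed

lemma cell_times_Int:
  assumes "x \<in> cells G" "x' \<in> cells G"
  shows "cell_times x y \<inter> cell_times x' y' = cell_times (x \<inter> x') (y \<inter> y')"
  using cell_length[OF assms(1)] cell_length[OF assms(2)]
  unfolding cell_times_def by (auto simp: image_iff)

lemma cell_times_empty_iff: "cell_times x y = {} \<longleftrightarrow> x = {} \<or> y = {}"
  by (auto simp: cell_times_def)

lemma cell_times_subset_iff:
  assumes "x \<in> cells G" "x' \<in> cells G" "y \<in> cells H" "y' \<in> cells H"
  shows "cell_times x y \<subseteq> cell_times x' y' \<longleftrightarrow> x \<subseteq> x' \<and> y \<subseteq> y'"
proof
  assume L: "cell_times x y \<subseteq> cell_times x' y'"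
  have *: "a \<in> x' \<and> b \<in> y'" if "a \<in> x" "b \<in> y" for a b
  proof -
    have "a @ b \<in> cell_times x' y'" using L that by (auto simp: cell_times_def)
    then obtain a' b' where "a @ b = a' @ b'" "a' \<in> x'" "b' \<in> y'"
      by (auto simp: cell_times_def)
    moreover have "length a = length a'"
      using cell_length[OF assms(1) that(1)] cell_length[OF assms(2) calculation(2)] by simp
    ultimately show ?thesis using that by simp
  qed
  obtain a0 b0 where "a0 \<in> x" "b0 \<in> y"
    using cell_nonempty assms by (metis ex_in_conv)
  then show "x \<subseteq> x' \<and> y \<subseteq> y'"
    using *[OF _ \<open>b0 \<in> y\<close>] *[OF \<open>a0 \<in> x\<close>] by (meson subsetI)
next
  assume "x \<subseteq> x' \<and> y \<subseteq> y'"
  then have "x \<times> y \<subseteq> x' \<times> y'" by (simp add: Sigma_mono)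
  then show "cell_times x y \<subseteq> cell_times x' y'"
    unfolding cell_times_def by (rule image_mono)
qed

lemma cell_times_eq_iff:
  assumes "x \<in> cells G" "x' \<in> cells G" "y \<in> cells H" "y' \<in> cells H"
  shows "cell_times x y = cell_times x' y' \<longleftrightarrow> x = x' \<and> y = y'"
proof
  assume "cell_times x y = cell_times x' y'"
  then have "cell_times x y \<subseteq> cell_times x' y'" "cell_times x' y' \<subseteq> cell_times x y"
    by simp_all
  then show "x = x' \<and> y = y'"
    unfolding cell_times_subset_iff[OF assms] cell_times_subset_iff[OF assms(2,1,4,3)]
    by (simp add: subset_antisym)
qed simp


section \<open>Isomorphism and products\<close>

definition pairs_iso ::
  "'a set set \<Rightarrow> 'b set set \<Rightarrow> 'c product_complex \<Rightarrow> bool" where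
  "pairs_iso A B P \<longleftrightarrow> (\<exists>f. bij_betw f (A \<times> B) (cells P) \<and>
     (\<forall>x\<in>A. \<forall>y\<in>B. \<forall>x'\<in>A. \<forall>y'\<in>B. f (x, y) \<subseteq> f (x', y') \<longleftrightarrow> x \<subseteq> x' \<and> y \<subseteq> y'))"

lemma pairs_iso_times: "pairs_iso (cells G) (cells H) (complex_times G H)"
  unfolding pairs_iso_def
proof (intro exI conjI ballI)
  have "inj_on (\<lambda>(x, y). cell_times x y) (cells G \<times> cells H)"
  proof (rule inj_onI)
    fix p q
    assume "p \<in> cells G \<times> cells H" "q \<in> cells G \<times> cells H"
      "(case p of (x, y) \<Rightarrow> cell_times x y) = (case q of (x, y) \<Rightarrow> cell_times x y)"
    then show "p = q"
      using cell_times_eq_iff[of "fst p" G "fst q" "snd p" H "snd q"]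
      by (simp add: split_def mem_Times_iff prod_eq_iff)
  qed
  then show "bij_betw (\<lambda>(x, y). cell_times x y) (cells G \<times> cells H) (cells (complex_times G H))"
    by (simp add: bij_betw_def cells_times)
next
  fix x x' y y' assume "x \<in> cells G" "y \<in> cells H" "x' \<in> cells G" "y' \<in> cells H"
  then show "(case (x, y) of (x, y) \<Rightarrow> cell_times x y) \<subseteq> (case (x', y') of (x, y) \<Rightarrow> cell_times x y) \<longleftrightarrow>
      x \<subseteq> x' \<and> y \<subseteq> y'"
    using cell_times_subset_iff[of x G x' y H y'] by (simp only: prod.case)
qed

lemma iso_refl: "complex_iso G G"
  unfolding complex_iso_def by (rule exI[of _ id]) auto

lemma iso_transfer_pairs:
  fixes P Q :: "'v product_complex"
  assumes P: "pairs_iso A B P" and Q: "pairs_iso C D Q"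
    and h: "bij_betw h (A \<times> B) (C \<times> D)"
    and hle: "\<And>x y x' y'. x \<in> A \<Longrightarrow> y \<in> B \<Longrightarrow> x' \<in> A \<Longrightarrow> y' \<in> B \<Longrightarrow>
       fst (h (x, y)) \<subseteq> fst (h (x', y')) \<and> snd (h (x, y)) \<subseteq> snd (h (x', y')) \<longleftrightarrow> x \<subseteq> x' \<and> y \<subseteq> y'"
  shows "complex_iso P Q"
proof -
  obtain f where f0: "bij_betw f (A \<times> B) (cells P)" and
    f1: "\<forall>x\<in>A. \<forall>y\<in>B. \<forall>x'\<in>A. \<forall>y'\<in>B. f (x, y) \<subseteq> f (x', y') \<longleftrightarrow> x \<subseteq> x' \<and> y \<subseteq> y'"
    using P unfolding pairs_iso_def by (elim exE conjE)
  note f = f0 f1[rule_format]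
  obtain g where g0: "bij_betw g (C \<times> D) (cells Q)" and
    g1: "\<forall>x\<in>C. \<forall>y\<in>D. \<forall>x'\<in>C. \<forall>y'\<in>D. g (x, y) \<subseteq> g (x', y') \<longleftrightarrow> x \<subseteq> x' \<and> y \<subseteq> y'"
    using Q unfolding pairs_iso_def by (elim exE conjE)
  note g = g0 g1[rule_format]
  define k where "k = g \<circ> h \<circ> inv_into (A \<times> B) f"
  have bij: "bij_betw k (cells P) (cells Q)"
    unfolding k_def by (rule bij_betw_trans[OF bij_betw_inv_into[OF f(1)] bij_betw_trans[OF h g(1)]])
  have "k p \<subseteq> k q \<longleftrightarrow> p \<subseteq> q" if p: "p \<in> cells P" and q: "q \<in> cells P" for p q
  proof -
    have "p \<in> f ` (A \<times> B)" using p f(1) by (simp add: bij_betw_imp_surj_on)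
    then obtain x y where xy: "p = f (x, y)" "x \<in> A" "y \<in> B"
      by (elim imageE SigmaE) simp
    have "q \<in> f ` (A \<times> B)" using q f(1) by (simp add: bij_betw_imp_surj_on)
    then obtain x' y' where xy': "q = f (x', y')" "x' \<in> A" "y' \<in> B"
      by (elim imageE SigmaE) simp
    have kp: "k p = g (h (x, y))"
      using xy f(1) by (simp add: k_def bij_betw_def inv_into_f_f)
    have kq: "k q = g (h (x', y'))"
      using xy' f(1) by (simp add: k_def bij_betw_def inv_into_f_f)
    have "h (x, y) \<in> C \<times> D" "h (x', y') \<in> C \<times> D"
      using h xy xy' by (auto simp: bij_betw_def)
    then have "fst (h (x, y)) \<in> C" "snd (h (x, y)) \<in> D" "fst (h (x', y')) \<in> C" "snd (h (x', y')) \<in> D"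
      by (auto simp: mem_Times_iff)
    then have "k p \<subseteq> k q \<longleftrightarrow>
        fst (h (x, y)) \<subseteq> fst (h (x', y')) \<and> snd (h (x, y)) \<subseteq> snd (h (x', y'))"
      unfolding kp kq
      using g(2)[of "fst (h (x, y))" "snd (h (x, y))" "fst (h (x', y'))" "snd (h (x', y'))"] by simp
    then show ?thesis
      using hle[of x y x' y'] f(2)[of x y x' y'] xy xy' by simp
  qed
  with bij show ?thesis unfolding complex_iso_def by (intro exI[of _ k]) simp
qed

lemma iso_times_left:
  assumes "complex_iso G G'" shows "complex_iso (complex_times G H) (complex_times G' H)"
proof -
  obtain f where f: "bij_betw f (cells G) (cells G')"
      "\<forall>x\<in>cells G. \<forall>y\<in>cells G. f x \<subseteq> f y \<longleftrightarrow> x \<subseteq> y"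
    using assms unfolding complex_iso_def by (elim exE conjE)
  have bij: "bij_betw (\<lambda>(x, y). (f x, y)) (cells G \<times> cells H) (cells G' \<times> cells H)"
    using bij_betw_imageI f(1) by (auto simp: bij_betw_def inj_on_def image_paired_Times[where g = "\<lambda>y. y"])
  show ?thesis
    by (rule iso_transfer_pairs[OF pairs_iso_times pairs_iso_times bij]) (simp add: f(2))
qed

lemma iso_times_commute: "complex_iso (complex_times G H) (complex_times H G)"
proof -
  have bij: "bij_betw (\<lambda>(x, y). (y, x)) (cells G \<times> cells H) (cells H \<times> cells G)"
    by (auto simp: bij_betw_def inj_on_def)
  show ?thesis
    by (rule iso_transfer_pairs[OF pairs_iso_times pairs_iso_times bij]) auto
qed

lemma cells_K1: "cells K1 = {{[undefined]}}"
  by (auto simp: cells_def K1_def simplices_one_point set_Cons_def)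

lemma iso_times_K1: "complex_iso (complex_times K1 G) G"
proof -
  have "pairs_iso (cells K1) (cells G) G"
    unfolding pairs_iso_def
    by (rule exI[of _ snd]) (auto simp: bij_betw_def inj_on_def cells_K1)
  then show ?thesis
    by (rule iso_transfer_pairs[OF pairs_iso_times _ bij_betw_id]) simp
qed

lemma complex_times_assoc:
  "complex_times (complex_times G H) K = complex_times G (complex_times H K)"
  by (rule iffD1[OF factors_inject]) simp


section \<open>Connected components and products\<close>

definition set_times :: "'v list set set \<Rightarrow> 'v list set set \<Rightarrow> 'v list set set" where
  "set_times C D = (\<lambda>(x, y). cell_times x y) ` (C \<times> D)"

lemma rtrancl_intersecting_cells:
  "(x, y) \<in> (intersecting G)\<^sup>* \<Longrightarrow> x \<in> cells G \<Longrightarrow> y \<in> cells G"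
  by (induction rule: rtrancl_induct) (auto simp: intersecting_def)

lemma sym_intersecting: "sym (intersecting G)"
  by (auto simp: sym_def intersecting_def)

lemma rtrancl_intersecting_sym:
  "(x, y) \<in> (intersecting G)\<^sup>* \<Longrightarrow> (y, x) \<in> (intersecting G)\<^sup>*"
  using sym_rtrancl[OF sym_intersecting] by (auto simp: sym_def)

lemma rtrancl_intersecting_times:
  assumes "x \<in> cells G" "y \<in> cells H"
  shows "(cell_times x y, z) \<in> (intersecting (complex_times G H))\<^sup>* \<longleftrightarrow>
    (\<exists>x' y'. z = cell_times x' y' \<and> (x, x') \<in> (intersecting G)\<^sup>* \<and> (y, y') \<in> (intersecting H)\<^sup>*)"
    (is "?L \<longleftrightarrow> ?R")
proof
  assume ?L
  then show ?R
  proof (induction rule: rtrancl_induct)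
    case (step z w)
    then obtain x' y' where 1: "z = cell_times x' y'" "(x, x') \<in> (intersecting G)\<^sup>*"
      "(y, y') \<in> (intersecting H)\<^sup>*" by blast
    obtain x'' y'' where 2: "w = cell_times x'' y''" "x'' \<in> cells G" "y'' \<in> cells H"
      using step(2) by (auto simp: intersecting_def cells_times)
    have 3: "x' \<in> cells G" "y' \<in> cells H"
      using 1 assms rtrancl_intersecting_cells by blast+
    have "cell_times (x' \<inter> x'') (y' \<inter> y'') \<noteq> {}"
      using step(2) 1 2 3 by (simp add: intersecting_def cell_times_Int)
    then have "(x', x'') \<in> intersecting G" "(y', y'') \<in> intersecting H"
      using 2 3 by (auto simp: intersecting_def cell_times_empty_iff)
    with 1 have "(x, x'') \<in> (intersecting G)\<^sup>*" "(y, y'') \<in> (intersecting H)\<^sup>*"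
      by (simp_all add: rtrancl_into_rtrancl)
    with 2 show ?case by blast
  qed (use assms in blast)
next
  assume ?R
  then obtain x' y' where z: "z = cell_times x' y'" "(x, x') \<in> (intersecting G)\<^sup>*"
    "(y, y') \<in> (intersecting H)\<^sup>*" by blast
  have x': "x' \<in> cells G" using z(2) assms rtrancl_intersecting_cells by blast
  have "(cell_times x y, cell_times x' y) \<in> (intersecting (complex_times G H))\<^sup>*"
    using z(2)
  proof (induction rule: rtrancl_induct)
    case (step u w)
    then have "u \<in> cells G" "w \<in> cells G" "u \<inter> w \<noteq> {}" by (auto simp: intersecting_def)
    then have "(cell_times u y, cell_times w y) \<in> intersecting (complex_times G H)"
      using assms cell_nonempty[OF assms(2)]
      by (auto simp: intersecting_def cells_times cell_times_Int cell_times_empty_iff)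
    with step show ?case by (meson rtrancl.rtrancl_into_rtrancl)
  qed simp
  also have "(cell_times x' y, cell_times x' y') \<in> (intersecting (complex_times G H))\<^sup>*"
    using z(3)
  proof (induction rule: rtrancl_induct)
    case (step u w)
    then have "u \<in> cells H" "w \<in> cells H" "u \<inter> w \<noteq> {}" by (auto simp: intersecting_def)
    then have "(cell_times x' u, cell_times x' w) \<in> intersecting (complex_times G H)"
      using x' cell_nonempty[OF x']
      by (auto simp: intersecting_def cells_times cell_times_Int cell_times_empty_iff)
    with step show ?case by (meson rtrancl.rtrancl_into_rtrancl)
  qed simp
  finally show ?L using z(1) by simp
qed

lemma components_times:
  "conn_components (complex_times G H) = (\<lambda>(C, D). set_times C D) ` (conn_components G \<times> conn_components H)"
proof -
  have *: "(intersecting (complex_times G H))\<^sup>* `` {cell_times x y} =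
      set_times ((intersecting G)\<^sup>* `` {x}) ((intersecting H)\<^sup>* `` {y})"
    if "x \<in> cells G" "y \<in> cells H" for x y
    using rtrancl_intersecting_times[OF that] by (auto simp: set_times_def)
  show ?thesis
    unfolding conn_components_def quotient_def cells_times
    using * by (force simp: image_iff)
qed

lemma component_subset: "C \<in> conn_components G \<Longrightarrow> C \<subseteq> cells G"
  by (auto simp: conn_components_def quotient_def dest: rtrancl_intersecting_cells)

lemma component_nonempty: "C \<in> conn_components G \<Longrightarrow> C \<noteq> {}"
  by (auto simp: conn_components_def quotient_def)

lemma finite_components [simp]: "finite (conn_components G)"
  by (rule finite_subset[of _ "Pow (cells G)"]) (auto dest: component_subset)

lemma component_disjoint:
  assumes "C \<in> conn_components G" "D \<in> conn_components G" "x \<in> C" "x \<in> D" shows "C = D"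
proof -
  obtain c where c: "C = (intersecting G)\<^sup>* `` {c}" using assms by (auto simp: conn_components_def quotient_def)
  obtain d where d: "D = (intersecting G)\<^sup>* `` {d}" using assms by (auto simp: conn_components_def quotient_def)
  have "(c, d) \<in> (intersecting G)\<^sup>*" "(d, c) \<in> (intersecting G)\<^sup>*"
    using assms c d rtrancl_intersecting_sym by (meson Image_singleton_iff rtrancl_trans)+
  then show ?thesis unfolding c d by (auto intro: rtrancl_trans)
qed

lemma Union_components: "\<Union> (conn_components G) = cells G"
proof
  show "cells G \<subseteq> \<Union> (conn_components G)" by (auto simp: conn_components_def quotient_def)
qed (use component_subset in blast)

lemma components_of_component:
  assumes "cells H \<in> conn_components G" shows "conn_components H = {cells H}"
proof -
  have *: "(intersecting H)\<^sup>* `` {x} = cells H" if x: "x \<in> cells H" for x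
  proof
    show "(intersecting H)\<^sup>* `` {x} \<subseteq> cells H" using x rtrancl_intersecting_cells by blast
    show "cells H \<subseteq> (intersecting H)\<^sup>* `` {x}"
    proof
      fix y assume y: "y \<in> cells H"
      obtain c where c: "cells H = (intersecting G)\<^sup>* `` {c}"
        using assms by (auto simp: conn_components_def quotient_def)
      have xy: "(c, x) \<in> (intersecting G)\<^sup>*" "(c, y) \<in> (intersecting G)\<^sup>*" using x y c by auto
      then have "(x, y) \<in> (intersecting G)\<^sup>*" using rtrancl_intersecting_sym by (meson rtrancl_trans)
      then have "(x, y) \<in> (intersecting H)\<^sup>*"
      proof (induction rule: rtrancl_induct)
        case (step u w)
        have "(c, u) \<in> (intersecting G)\<^sup>*" using step xy by (meson rtrancl_trans)
        moreover have "(c, w) \<in> (intersecting G)\<^sup>*" using calculation step(2) by simp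
        ultimately have "u \<in> cells H" "w \<in> cells H" using c by auto
        then have "(u, w) \<in> intersecting H" using step(2) by (auto simp: intersecting_def)
        with step show ?case by simp
      qed simp
      then show "y \<in> (intersecting H)\<^sup>* `` {x}" by simp
    qed
  qed
  have "cells H \<noteq> {}" using component_nonempty[OF assms] .
  with * show ?thesis unfolding conn_components_def quotient_def by auto
qed

lemma simplicial_component_exists:
  assumes C: "C \<in> conn_components (of_simplicial_complex S)"
  shows "\<exists>H. cells H = C"
proof -
  let ?G = "of_simplicial_complex S"
  define S' where "S' = {x \<in> simplices S. listset [x] \<in> C}"
  have G: "cells ?G = (\<lambda>x. listset [x]) ` simplices S"
    by (force simp: cells_def factors_simps(1) set_Cons_def image_iff)
  obtain c where c: "C = (intersecting ?G)\<^sup>* `` {c}"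
    using C by (auto simp: conn_components_def quotient_def)
  have closed: "y \<in> S'" if x: "x \<in> S'" and y: "y \<subseteq> x" "y \<noteq> {}" for x y
  proof -
    have yS: "y \<in> simplices S" using x y simplices_props(3) by (auto simp: S'_def)
    obtain v where v: "v \<in> y" using y by auto
    have "[v] \<in> listset [x] \<inter> listset [y]" using v y by (auto simp: set_Cons_def)
    then have "(listset [x], listset [y]) \<in> intersecting ?G"
      using x yS unfolding intersecting_def G S'_def by blast
    moreover have "(c, listset [x]) \<in> (intersecting ?G)\<^sup>*" using x c by (simp add: S'_def)
    ultimately have "listset [y] \<in> C" unfolding c by (auto intro: rtrancl_into_rtrancl)
    with yS show ?thesis by (simp add: S'_def)
  qed
  have sub: "S' \<subseteq> simplices S" by (auto simp: S'_def)
  have "is_simplicial_complex S'"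
    unfolding is_simplicial_complex_def
  proof (intro conjI ballI allI impI)
    show "finite S'" using sub simplices_props(1) by (rule finite_subset)
  next
    fix x assume "x \<in> S'"
    then show "finite x" "x \<noteq> {}" using sub simplices_props(2,4) by blast+
  next
    fix x y assume "x \<in> S'" "y \<subseteq> x \<and> y \<noteq> {}"
    then show "y \<in> S'" using closed by blast
  qed
  then have "simplices (Simplicial_complex S') = S'" by (simp add: Simplicial_complex_inverse)
  then have "cells (of_simplicial_complex (Simplicial_complex S')) = (\<lambda>x. listset [x]) ` S'"
    by (force simp: cells_def factors_simps(1) set_Cons_def image_iff)
  also have "\<dots> = C" using component_subset[OF C] unfolding G S'_def by auto
  finally show ?thesis by blast
qed

lemma component_exists: "C \<in> conn_components G \<Longrightarrow> \<exists>H. cells H = C"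
proof (induction "factors G" arbitrary: G C)
  case Nil
  then show ?case using factors[of G] by simp
next
  case (Cons S Ss)
  show ?case
  proof (cases "Ss = []")
    case True
    then have "G = of_simplicial_complex S"
      using Cons(2) by (metis factors_inject factors_simps(1))
    with Cons(3) simplicial_component_exists show ?thesis by blast
  next
    case False
    define G' where "G' = Product_complex Ss"
    have G': "factors G' = Ss" using False by (simp add: G'_def Product_complex_inverse)
    have "factors G = factors (complex_times (of_simplicial_complex S) G')"
      using Cons(2) G' by simp
    then have G: "G = complex_times (of_simplicial_complex S) G'" by (rule iffD1[OF factors_inject])
    obtain D E where DE: "C = set_times D E" "D \<in> conn_components (of_simplicial_complex S)"
      "E \<in> conn_components G'" using Cons(3) unfolding G components_times by auto
    obtain H where H: "cells H = D" using simplicial_component_exists DE(2) by blast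
    obtain H' where H': "cells H' = E" using Cons(1)[OF G'[symmetric] DE(3)] by blast
    have "cells (complex_times H H') = C"
      unfolding cells_times H H' DE(1) set_times_def ..
    then show ?thesis by blast
  qed
qed

lemma split_exists: "\<exists>Hs. image_mset cells Hs = mset_set (conn_components G)"
proof -
  define h where "h C = (SOME H. cells H = C)" for C :: "'a list set set"
  have h: "cells (h C) = C" if "C \<in> conn_components G" for C
    unfolding h_def using someI_ex[OF component_exists[OF that]] .
  have "image_mset cells (image_mset h (mset_set (conn_components G))) =
      image_mset (\<lambda>C. C) (mset_set (conn_components G))"
    unfolding image_mset.compositionality by (rule image_mset_cong) (auto simp: h)
  then show ?thesis by auto
qed

lemma mset_set_UNION_disjoint:
  assumes "finite A" "\<And>a. a \<in> A \<Longrightarrow> finite (F a)"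
    and "\<And>a b. a \<in> A \<Longrightarrow> b \<in> A \<Longrightarrow> a \<noteq> b \<Longrightarrow> F a \<inter> F b = {}"
  shows "(\<Sum>a\<in>#mset_set A. mset_set (F a)) = mset_set (\<Union>a\<in>A. F a)"
  using assms
proof (induction A rule: finite_induct)
  case (insert a A)
  have "F a \<inter> (\<Union>b\<in>A. F b) = {}" using insert by fastforce
  then have "mset_set (F a \<union> (\<Union>b\<in>A. F b)) = mset_set (F a) + mset_set (\<Union>b\<in>A. F b)"
    using insert by (intro mset_set_Union) auto
  with insert show ?case by simp
qed simp

lemma split_times:
  assumes Hs: "image_mset cells Hs = mset_set (conn_components G)"
    and L: "\<And>H. image_mset cells (L H) = mset_set (conn_components (complex_times H K))"
  shows "image_mset cells (\<Sum>H\<in>#Hs. L H) = mset_set (conn_components (complex_times G K))"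
proof -
  let ?F = "\<lambda>C. (\<lambda>D. set_times C D) ` conn_components K"
  have comp: "conn_components (complex_times H K) = ?F (cells H)" if "H \<in># Hs" for H
  proof -
    have "cells H \<in># mset_set (conn_components G)" unfolding Hs[symmetric] using that by auto
    then have "conn_components H = {cells H}" by (intro components_of_component) simp
    then show ?thesis by (auto simp: components_times)
  qed
  have disj: "?F C \<inter> ?F D = {}"
    if C: "C \<in> conn_components G" and D: "D \<in> conn_components G" and ne: "C \<noteq> D" for C D
  proof (rule ccontr)
    assume "?F C \<inter> ?F D \<noteq> {}"
    then obtain U V where UV: "U \<in> conn_components K" "V \<in> conn_components K" "set_times C U = set_times D V"
      by auto
    obtain x y where xy: "x \<in> C" "y \<in> U" using C UV component_nonempty by (metis ex_in_conv)
    then have "cell_times x y \<in> set_times D V" unfolding UV(3)[symmetric] by (auto simp: set_times_def)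
    then obtain x' y' where xy': "x' \<in> D" "y' \<in> V" "cell_times x y = cell_times x' y'"
      by (auto simp: set_times_def)
    have "x = x'"
      using cell_times_eq_iff[of x G x' y K y'] xy xy' C D UV component_subset by blast
    with component_disjoint[OF C D] xy xy' ne show False by blast
  qed
  have "image_mset cells (\<Sum>H\<in>#Hs. L H) = (\<Sum>H\<in>#Hs. image_mset cells (L H))"
    by (induction Hs) auto
  also have "\<dots> = (\<Sum>H\<in>#Hs. mset_set (?F (cells H)))"
    by (intro arg_cong[where f = sum_mset] image_mset_cong) (simp add: L comp)
  also have "\<dots> = (\<Sum>C\<in>#image_mset cells Hs. mset_set (?F C))"
    by (simp add: image_mset.compositionality comp_def)
  also have "\<dots> = mset_set (\<Union>C\<in>conn_components G. ?F C)"
    unfolding Hs by (rule mset_set_UNION_disjoint) (use disj in auto)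
  also have "(\<Union>C\<in>conn_components G. ?F C) = conn_components (complex_times G K)"
    by (auto simp: components_times)
  finally show ?thesis .
qed


section \<open>Compatibility of the operations\<close>

lemma sc_equiv_add: "sc_equiv X X' \<Longrightarrow> sc_equiv Y Y' \<Longrightarrow> sc_equiv (X + Y) (X' + Y')"
  by (metis sc_equiv.add sc_equiv.trans add.commute)

lemma sc_equiv_sum:
  "(\<And>a. a \<in># M \<Longrightarrow> sc_equiv (F a) (F' a)) \<Longrightarrow> sc_equiv (\<Sum>a\<in>#M. F a) (\<Sum>a\<in>#M. F' a)"
  by (induction M) (auto intro: sc_equiv_add sc_equiv.refl)

lemma sum_mset_singletons: "(\<Sum>a\<in>#M. {#f a#}) = image_mset f M"
  by (induction M) auto

lemma sc_equiv_image:
  assumes "\<And>a. a \<in># M \<Longrightarrow> sc_equiv {#f a#} {#g a#}"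
  shows "sc_equiv (image_mset f M) (image_mset g M)"
  using sc_equiv_sum[of M "\<lambda>a. {#f a#}" "\<lambda>a. {#g a#}"] assms by (simp only: sum_mset_singletons)

lemma uminus_uminus_sign [simp]: "- (- s) = (s :: sign)"
  by transfer auto

lemma uminus_times_sign: "- s * t = - (s * t :: sign)"
  by transfer auto

lemma sc_uminus_simps [simp]:
  "sc_uminus {#} = {#}" "sc_uminus (X + Y) = sc_uminus X + sc_uminus Y"
  "sc_uminus (add_mset (s, G) X) = add_mset (- s, G) (sc_uminus X)"
  by (simp_all add: sc_uminus_def)

lemma sc_uminus_uminus [simp]: "sc_uminus (sc_uminus X) = X"
  by (induction X) auto

lemma sc_uminus_Pair: "sc_uminus (image_mset (Pair s) Hs) = image_mset (Pair (- s)) Hs"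
  by (simp add: sc_uminus_def image_mset.compositionality comp_def)

lemma sc_uminus_cong: "sc_equiv X Y \<Longrightarrow> sc_equiv (sc_uminus X) (sc_uminus Y)"
proof (induction rule: sc_equiv.induct)
  case (split Hs G s)
  then show ?case using sc_equiv.split[of Hs G "- s"] by (simp add: sc_uminus_Pair)
next
  case (cancel X)
  then show ?case using sc_equiv.cancel[of "sc_uminus X"] by simp
qed (auto intro: sc_equiv.intros)

lemma sc_times_simps [simp]:
  "sc_times {#} Y = {#}" "sc_times X {#} = {#}"
  "sc_times (X + X') Y = sc_times X Y + sc_times X' Y"
  "sc_times X (Y + Y') = sc_times X Y + sc_times X Y'"
  "sc_times (add_mset (s, G) X) Y =
     image_mset (\<lambda>(t, H). (s * t, complex_times G H)) Y + sc_times X Y"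
  by (auto simp: sc_times_def split_def sum_mset.distrib)

lemma sc_times_add_right:
  "sc_times X (add_mset (t, H) Y) =
     image_mset (\<lambda>(s, G). (s * t, complex_times G H)) X + sc_times X Y"
  by (induction X) (auto simp: algebra_simps)

lemma sc_times_uminus: "sc_times (sc_uminus X) Y = sc_uminus (sc_times X Y)"
proof (induction X)
  case (add p X)
  obtain s G where [simp]: "p = (s, G)" by fastforce
  have "image_mset (\<lambda>(t, H). (- s * t, complex_times G H)) Y =
      sc_uminus (image_mset (\<lambda>(t, H). (s * t, complex_times G H)) Y)"
    by (simp add: sc_uminus_def image_mset.compositionality comp_def split_def uminus_times_sign)
  with add show ?case by simp
qed simp

lemma sc_times_assoc: "sc_times (sc_times X Y) Z = sc_times X (sc_times Y Z)"
proof (induction X)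
  case (add p X)
  obtain s G where [simp]: "p = (s, G)" by fastforce
  have "sc_times (image_mset (\<lambda>(t, H). (s * t, complex_times G H)) Y) Z =
      image_mset (\<lambda>(t, H). (s * t, complex_times G H)) (sc_times Y Z)"
  proof (induction Y)
    case (add q Y)
    obtain t H where [simp]: "q = (t, H)" by fastforce
    show ?case using add
      by (simp add: image_mset.compositionality comp_def split_def mult.assoc complex_times_assoc)
  qed simp
  with add show ?case by simp
qed simp

lemma sc_times_commute: "sc_equiv (sc_times X Y) (sc_times Y X)"
proof (induction X)
  case (add p X)
  obtain s G where [simp]: "p = (s, G)" by fastforce
  have "sc_equiv (image_mset (\<lambda>(t, H). (s * t, complex_times G H)) Y)
      (image_mset (\<lambda>(t, H). (t * s, complex_times H G)) Y)"
    by (rule sc_equiv_image)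
      (auto simp: mult.commute intro: sc_equiv.iso iso_times_commute)
  with add show ?case by (simp add: sc_times_add_right sc_equiv_add)
qed (simp add: sc_equiv.refl)

lemma sc_times_cong_left: "sc_equiv X Y \<Longrightarrow> sc_equiv (sc_times X Z) (sc_times Y Z)"
proof (induction rule: sc_equiv.induct)
  case (iso G H s)
  then show ?case
    by (auto intro!: sc_equiv_image intro: sc_equiv.iso iso_times_left)
next
  case (split Hs G s)
  have "sc_equiv {#(s * t, complex_times G K)#}
      (image_mset (\<lambda>(s, G). (s * t, complex_times G K)) (image_mset (Pair s) Hs))" for t K
  proof -
    obtain L where L: "\<And>H. image_mset cells (L H) = mset_set (conn_components (complex_times H K))"
      using choice[of "\<lambda>H Hs. image_mset cells Hs = mset_set (conn_components (complex_times H K))"]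
        split_exists by blast
    have "sc_equiv {#(s * t, complex_times G K)#} (image_mset (Pair (s * t)) (\<Sum>H\<in>#Hs. L H))"
      by (rule sc_equiv.split[OF split_times[OF split L]])
    also have "image_mset (Pair (s * t)) (\<Sum>H\<in>#Hs. L H) =
        (\<Sum>H\<in>#Hs. image_mset (Pair (s * t)) (L H))"
      by (induction Hs) auto
    finally have 1: "sc_equiv {#(s * t, complex_times G K)#} (\<Sum>H\<in>#Hs. image_mset (Pair (s * t)) (L H))" .
    have 2: "sc_equiv (\<Sum>H\<in>#Hs. image_mset (Pair (s * t)) (L H))
        (\<Sum>H\<in>#Hs. {#(s * t, complex_times H K)#})"
      by (rule sc_equiv_sum) (rule sc_equiv.sym[OF sc_equiv.split[OF L]])
    from sc_equiv.trans[OF 1 2] show ?thesis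
      by (simp add: sum_mset_singletons image_mset.compositionality comp_def)
  qed
  then have *: "sc_equiv (sc_times {#(s, G)#} {#(t, K)#}) (sc_times (image_mset (Pair s) Hs) {#(t, K)#})"
    for t K by (simp add: sc_times_add_right)
  show ?case
  proof (induction Z)
    case (add q Z)
    obtain t K where q: "q = (t, K)" by fastforce
    have **: "sc_times X (add_mset q Z) = sc_times X {#(t, K)#} + sc_times X Z" for X
      by (simp add: q sc_times_add_right)
    show ?case unfolding **[of "{#(s, G)#}"] **[of "image_mset (Pair s) Hs"]
      by (rule sc_equiv_add[OF * add])
  qed (simp add: sc_equiv.refl)
next
  case (cancel X)
  then show ?case by (simp add: sc_times_uminus sc_equiv.cancel)
qed (auto intro: sc_equiv.intros)

lemma sc_times_cong:
  "sc_equiv X X' \<Longrightarrow> sc_equiv Y Y' \<Longrightarrow> sc_equiv (sc_times X Y) (sc_times X' Y')"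
  by (meson sc_equiv.trans sc_times_commute sc_times_cong_left)

lemma sc_times_K1: "sc_equiv (sc_times {#(1, K1)#} X) X"
  using sc_equiv_image[of X "\<lambda>(t, H). (t, complex_times K1 H)" id]
  by (auto intro: sc_equiv.iso iso_times_K1)


section \<open>The number of cells, counted with signs\<close>

definition sc_size :: "'v signed_complex \<Rightarrow> int" where
  "sc_size X = (\<Sum>(s, G)\<in>#X. int_of_sign s * int (card (cells G)))"

lemma sc_size_add: "sc_size (X + Y) = sc_size X + sc_size Y"
  by (simp add: sc_size_def)

lemma sc_size_uminus: "sc_size (sc_uminus X) = - sc_size X"
  by (induction X) (auto simp: sc_size_def uminus_sign.rep_eq)

lemma sc_size_cong: "sc_equiv X Y \<Longrightarrow> sc_size X = sc_size Y"
proof (induction rule: sc_equiv.induct)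
  case (iso G H s)
  then show ?case by (auto simp: sc_size_def complex_iso_def dest: bij_betw_same_card)
next
  case (split Hs G s)
  have "card (cells G) = (\<Sum>C\<in>conn_components G. card C)"
    unfolding Union_components[symmetric]
    by (rule card_Union_disjoint)
      (auto simp: pairwise_def disjnt_def intro: finite_subset[OF component_subset]
        dest: component_disjoint)
  also have "\<dots> = (\<Sum>H\<in>#Hs. card (cells H))"
    unfolding sum_unfold_sum_mset split[symmetric]
    by (simp add: image_mset.compositionality comp_def)
  finally have "int (card (cells G)) = (\<Sum>H\<in>#Hs. int (card (cells H)))"
    by (simp add: comp_def image_mset.compositionality)
  then show ?case
    by (simp add: sc_size_def image_mset.compositionality comp_def sum_mset_distrib_left)
next
  case (cancel X)
  show ?case by (simp add: sc_size_add sc_size_uminus) (simp add: sc_size_def)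
qed (simp_all add: sc_size_add)


section \<open>The strong ring\<close>

quotient_type 'v strong_ring = "'v signed_complex" / sc_equiv
  by (rule equivp_sc_equiv)

instantiation strong_ring :: (type) comm_ring_1
begin

lift_definition zero_strong_ring :: "'a strong_ring" is "{#}" .

lift_definition one_strong_ring :: "'a strong_ring" is "{#(1, K1)#}" .

lift_definition plus_strong_ring :: "'a strong_ring \<Rightarrow> 'a strong_ring \<Rightarrow> 'a strong_ring" is "(+)"
  by (rule sc_equiv_add)

lift_definition uminus_strong_ring :: "'a strong_ring \<Rightarrow> 'a strong_ring" is sc_uminus
  by (rule sc_uminus_cong)

lift_definition minus_strong_ring :: "'a strong_ring \<Rightarrow> 'a strong_ring \<Rightarrow> 'a strong_ring"
  is "\<lambda>X Y. X + sc_uminus Y"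
  by (intro sc_equiv_add sc_uminus_cong)

lift_definition times_strong_ring :: "'a strong_ring \<Rightarrow> 'a strong_ring \<Rightarrow> 'a strong_ring" is sc_times
  by (rule sc_times_cong)

instance
proof
  fix a b c :: "'a strong_ring"
  show "a + b + c = a + (b + c)" by transfer (simp add: add.assoc sc_equiv.refl)
  show "a + b = b + a" by transfer (simp add: add.commute sc_equiv.refl)
  show "0 + a = a" by transfer (simp add: sc_equiv.refl)
  show "- a + a = 0" by transfer (simp add: add.commute sc_equiv.cancel)
  show "a - b = a + - b" by transfer (simp add: sc_equiv.refl)
  show "a * b * c = a * (b * c)" by transfer (simp add: sc_times_assoc sc_equiv.refl)
  show "a * b = b * a" by transfer (rule sc_times_commute)
  show "1 * a = a" by transfer (rule sc_times_K1)
  show "(a + b) * c = a * c + b * c" by transfer (simp add: sc_equiv.refl)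
  show "(0 :: 'a strong_ring) \<noteq> 1"
    by transfer (auto dest!: sc_size_cong simp: sc_size_def cells_K1 one_sign.rep_eq)
qed

end

lift_definition complex_class :: "'v product_complex \<Rightarrow> 'v strong_ring" is "\<lambda>G. {#(1, G)#}" .

definition multiplicative_prime :: "'v strong_ring \<Rightarrow> bool" where
  "multiplicative_prime p \<longleftrightarrow> p \<noteq> 0 \<and> p \<noteq> 1 \<and> p \<noteq> - 1 \<and>
     \<not> (\<exists>a b. p = a * b \<and> a \<noteq> 1 \<and> a \<noteq> - 1 \<and> b \<noteq> 1 \<and> b \<noteq> - 1)"

end

theory Submission
  imports Defs "HOL-Library.Poly_Mapping"
begin

text \<open>
  The strong ring is a polynomial ring over the integers: its variables are the classes of the connected
  simplicial complexes with at least two vertices, and its monomials are the classes of the non-empty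
  connected product complexes. Granted this, both claims are elementary. Any divisor of a monomial
  is a signed monomial (compare leading and lowest terms with respect to a monomial order), so the prime
  divisors of a monomial are its variables up to sign, and the variables themselves are prime.

  That the ring is a polynomial ring rests on the unique factorization of connected product
  complexes (lemma \<open>factors_unique\<close>). An isomorphism of cell posets is a bijection of vertices preserving
  the sets of vertices that form cells. Every edge of a product moves a single coordinate, its direction.
  Two edges at a common vertex have different directions exactly when some cell contains both of them while
  the set of their other end points is not a cell (lemma \<open>directions_differ_iff\<close>). So the isomorphism induces a
  bijection of directions at every vertex. Opposite sides of a square have the same direction, and the complex is
  connected by edges; hence this bijection is the same at all vertices (lemma \<open>vertex_iso_direction_map\<close>).
  It matches the copies of the factors through a vertex with the copies through the image vertex.

  Sending a product complex to the sum of the monomials of its connected components therefore respects all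
  relations of the strong ring and gives a ring homomorphism \<open>expansion\<close> into a polynomial ring. It
  is injective, as evaluating the variables at the classes that they stand for is a left inverse
  (lemma \<open>evaluate_expansion\<close>).
\<close>

section \<open>Vertices and edge directions of a product complex\<close>

definition vertices :: "'v product_complex \<Rightarrow> 'v list set" where
  "vertices G = \<Union> (cells G)"

abbreviation factor :: "'v product_complex \<Rightarrow> nat \<Rightarrow> 'v set set" where
  "factor G i \<equiv> simplices (factors G ! i)"

lemma mem_listset: "a \<in> listset xs \<longleftrightarrow> length a = length xs \<and> (\<forall>i<length xs. a ! i \<in> xs ! i)"
  by (auto simp: listset_conv list_all2_conv_all_nth)

lemma cells_iff:
  "x \<in> cells G \<longleftrightarrow>
     (\<exists>xs. length xs = dimension G \<and> (\<forall>i<dimension G. xs ! i \<in> factor G i) \<and> x = listset xs)"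
  by (auto simp: cells_def mem_listset dimension_def image_iff)

lemma vertices_length: "a \<in> vertices G \<Longrightarrow> length a = dimension G"
  by (auto simp: vertices_def cell_length)

lemma listset_singletons: "listset (map (\<lambda>v. {v}) a) = {a}"
  by (auto simp: mem_listset intro: nth_equalityI)

lemma vertices_iff:
  "a \<in> vertices G \<longleftrightarrow> length a = dimension G \<and> (\<forall>i<dimension G. {a ! i} \<in> factor G i)"
proof
  assume "a \<in> vertices G"
  then obtain xs where xs: "length xs = dimension G" "\<forall>i<dimension G. xs ! i \<in> factor G i"
    "a \<in> listset xs"
    by (auto simp: vertices_def cells_iff)
  then show "length a = dimension G \<and> (\<forall>i<dimension G. {a ! i} \<in> factor G i)"
    by (simp add: mem_listset) (metis empty_subsetI insert_not_empty insert_subset simplices_props(3))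
next
  assume "length a = dimension G \<and> (\<forall>i<dimension G. {a ! i} \<in> factor G i)"
  then have "{a} \<in> cells G"
    unfolding cells_iff by (intro exI[of _ "map (\<lambda>v. {v}) a"]) (simp add: listset_singletons)
  then show "a \<in> vertices G" by (auto simp: vertices_def)
qed

lemma singleton_cell_iff: "{a} \<in> cells G \<longleftrightarrow> a \<in> vertices G"
proof
  assume "a \<in> vertices G"
  then show "{a} \<in> cells G"
    unfolding cells_iff vertices_iff
    by (intro exI[of _ "map (\<lambda>v. {v}) a"]) (simp add: listset_singletons)
qed (auto simp: vertices_def)

lemma cell_subset_vertices: "x \<in> cells G \<Longrightarrow> x \<subseteq> vertices G"
  by (auto simp: vertices_def)

text \<open>
  Being a box, a cell contains with two vertices every vertex that mixes their coordinates. This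
  closure property lets the arguments below speak about vertices instead of lists of simplices.
\<close>

lemma cell_closed_update:
  assumes "x \<in> cells G" "a \<in> x" "b \<in> x"
  shows "a[i := b ! i] \<in> x"
proof -
  obtain xs where xs: "x = listset xs" using assms(1) by (auto simp: cells_iff)
  show ?thesis
    using assms(2,3) unfolding xs mem_listset
    by (cases "i < length xs") (auto simp: nth_list_update)
qed

lemma cell_coordinates:
  assumes x: "x \<in> cells G" and i: "i < dimension G" and y: "y \<noteq> {}" "y \<subseteq> (\<lambda>a. a ! i) ` x"
  shows "y \<in> factor G i"
proof -
  obtain xs where xs: "length xs = dimension G" "\<forall>i<dimension G. xs ! i \<in> factor G i" "x = listset xs"
    using x by (auto simp: cells_iff)
  have "y \<subseteq> xs ! i" using y(2) i xs by (auto simp: mem_listset)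
  with xs(2) i y(1) show ?thesis by (meson simplices_props(3))
qed

lemma line_cell_iff:
  assumes a: "a \<in> vertices G" and i: "i < dimension G"
  shows "(\<lambda>v. a[i := v]) ` x \<in> cells G \<longleftrightarrow> x \<in> factor G i"
proof
  assume L: "(\<lambda>v. a[i := v]) ` x \<in> cells G"
  have "(\<lambda>b. b ! i) ` (\<lambda>v. a[i := v]) ` x = x"
    using a i by (auto simp: image_image vertices_length)
  moreover have "x \<noteq> {}" using cell_nonempty[OF L] by auto
  ultimately show "x \<in> factor G i" using cell_coordinates[OF L i, of x] by simp
next
  assume x: "x \<in> factor G i"
  let ?xs = "(map (\<lambda>v. {v}) a)[i := x]"
  have "b \<in> (\<lambda>v. a[i := v]) ` x" if b: "b \<in> listset ?xs" for b
  proof -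
    have l: "length b = length a" using b by (simp add: mem_listset)
    have nth: "b ! j \<in> ?xs ! j" if "j < length a" for j using b that by (simp add: mem_listset)
    have "b ! j = a[i := b ! i] ! j" if "j < length b" for j
      using nth[of j] l that by (cases "j = i") simp_all
    then have "b = a[i := b ! i]" using l by (simp add: nth_equalityI)
    moreover have "b ! i \<in> x" using nth[of i] a i by (simp add: vertices_length)
    ultimately show ?thesis by blast
  qed
  moreover have "a[i := v] \<in> listset ?xs" if "v \<in> x" for v
    using that a i by (auto simp: mem_listset nth_list_update vertices_length)
  ultimately have "(\<lambda>v. a[i := v]) ` x = listset ?xs" by blast
  moreover have "\<forall>j<dimension G. ?xs ! j \<in> factor G j"
    using a x i by (auto simp: vertices_iff nth_list_update)
  ultimately show "(\<lambda>v. a[i := v]) ` x \<in> cells G"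
    using a unfolding cells_iff by (intro exI[of _ ?xs]) (simp add: vertices_length)
qed

text \<open>
  The 1-skeleton of a product complex is the Cartesian product of the 1-skeletons of its factors: an
  edge moves exactly one coordinate, along an edge of the corresponding factor. The index of that
  coordinate is the direction of the edge.
\<close>

definition step :: "'v product_complex \<Rightarrow> nat \<Rightarrow> 'v list \<Rightarrow> 'v list \<Rightarrow> bool" where
  "step G i a b \<longleftrightarrow> a \<in> vertices G \<and> i < dimension G \<and>
     (\<exists>v. v \<noteq> a ! i \<and> {a ! i, v} \<in> factor G i \<and> b = a[i := v])"

lemma stepD:
  assumes "step G i a b"
  shows "a \<in> vertices G" "b \<in> vertices G" "i < dimension G" "b ! i \<noteq> a ! i"
    "b = a[i := b ! i]" "{a ! i, b ! i} \<in> factor G i"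
proof -
  obtain v where v: "a \<in> vertices G" "i < dimension G" "v \<noteq> a ! i" "{a ! i, v} \<in> factor G i"
    "b = a[i := v]"
    using assms by (auto simp: step_def)
  have l: "length a = dimension G" using v(1) by (rule vertices_length)
  have bi: "b ! i = v" using v l by simp
  have "{v} \<in> factor G i" using v(4) by (rule simplices_props(3)) auto
  then show "b \<in> vertices G" using v by (auto simp: vertices_iff nth_list_update)
  show "a \<in> vertices G" "i < dimension G" "b ! i \<noteq> a ! i"
    "b = a[i := b ! i]" "{a ! i, b ! i} \<in> factor G i"
    using v bi by simp_all
qed

lemma step_nth: "step G i a b \<Longrightarrow> j \<noteq> i \<Longrightarrow> b ! j = a ! j"
  by (metis nth_list_update_neq stepD(5))

lemma step_unique: "step G i a b \<Longrightarrow> step G j a b \<Longrightarrow> i = j"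
  by (metis step_nth stepD(4))

lemma step_sym: 
  assumes "step G i a b" shows "step G i b a"
proof -
  have "a = b[i := a ! i]" using stepD(5)[OF assms] by (metis list_update_id list_update_overwrite)
  then show ?thesis
    unfolding step_def using stepD[OF assms] by (metis insert_commute)
qed

lemma step_ne: "step G i a b \<Longrightarrow> a \<noteq> b"
  using stepD(4) by metis

lemma step_edge: 
  assumes "step G i a b" shows "{a, b} \<in> cells G"
proof -
  have "(\<lambda>v. a[i := v]) ` {a ! i, b ! i} = {a, b}"
    using stepD(5)[OF assms] by simp
  then show ?thesis using line_cell_iff[OF stepD(1,3)[OF assms]] stepD(6)[OF assms] by metis
qed

lemma edge_step:
  assumes ab: "{a, b} \<in> cells G" and ne: "a \<noteq> b"
  shows "\<exists>i. step G i a b"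
proof -
  have V: "a \<in> vertices G" "b \<in> vertices G" using ab by (auto simp: vertices_def)
  then obtain i where i: "i < dimension G" "a ! i \<noteq> b ! i"
    using ne by (metis nth_equalityI vertices_length)
  have "a[i := b ! i] \<in> {a, b}" using cell_closed_update[OF ab] by simp
  moreover have "a[i := b ! i] \<noteq> a" using i V by (metis nth_list_update_eq vertices_length)
  ultimately have "b = a[i := b ! i]" by simp
  moreover have "{a ! i, b ! i} \<in> factor G i" using cell_coordinates[OF ab i(1)] by simp
  ultimately show ?thesis unfolding step_def using V i by metis
qed

lemma step_line:
  assumes "step G i b c" "a \<in> vertices G"
  shows "step G i (a[i := b ! i]) (a[i := c ! i])"
proof -
  note s = stepD[OF assms(1)]
  have "{b ! i} \<in> factor G i" using s by (simp add: vertices_iff)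
  then have "a[i := b ! i] \<in> vertices G" using assms(2) s(3) by (auto simp: vertices_iff nth_list_update)
  then show ?thesis
    unfolding step_def using s vertices_length[OF assms(2)] by auto
qed

lemma square_step:
  assumes "step G i a b" "step G j a c" "i \<noteq> j"
  shows "step G i c (c[i := b ! i])"
  using step_line[OF assms(1) stepD(2)[OF assms(2)]] step_nth[OF assms(2,3)] by (metis list_update_id)

text \<open>
  Two edges at \<open>a\<close> in different directions span the product of two edges, and this is the only cell
  with four vertices that contains both of them.
\<close>

lemma square_cell_iff:
  assumes ab: "step G i a b" and ac: "step G j a c" and ij: "i \<noteq> j"
  shows "{a, b, c, d} \<in> cells G \<longleftrightarrow> d = c[i := b ! i]"
proof
  assume L: "{a, b, c, d} \<in> cells G"
  let ?d = "c[i := b ! i]"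
  have "?d \<in> {a, b, c, d}" using cell_closed_update[OF L] by simp
  moreover have "?d ! i = b ! i" "?d ! j = c ! j"
    using ij stepD(3)[OF ab] vertices_length[OF stepD(2)[OF ac]] by simp_all
  then have "?d \<noteq> a" "?d \<noteq> b" "?d \<noteq> c"
    using stepD(4)[OF ab] stepD(4)[OF ac] step_nth[OF ab, of j] step_nth[OF ac, of i] ij by metis+
  ultimately show "d = ?d" by simp
next
  assume d: "d = c[i := b ! i]"
  let ?xs = "(map (\<lambda>v. {v}) a)[i := {a ! i, b ! i}, j := {a ! j, c ! j}]"
  note ab = stepD[OF ab] and ac = stepD[OF ac]
  have l: "length a = dimension G" using ab(1) by (rule vertices_length)
  have b_eq: "b = a[i := b ! i, j := a ! j]" using ab(5) ij by (metis list_update_id list_update_swap)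
  have c_eq: "c = a[i := a ! i, j := c ! j]" using ac(5) by simp
  have d_eq: "d = a[i := b ! i, j := c ! j]" using ac(5) ij d by (metis list_update_swap)
  have "listset ?xs = {a, b, c, d}"
  proof (intro equalityI subsetI)
    fix e assume e: "e \<in> listset ?xs"
    have le: "length e = length a" using e by (simp add: mem_listset)
    have nth: "e ! k \<in> ?xs ! k" if "k < length a" for k using e that by (simp add: mem_listset)
    have "e ! k = a[i := e ! i, j := e ! j] ! k" if "k < length e" for k
      using nth[of k] le that by (cases "k = j"; cases "k = i") simp_all
    then have eq: "e = a[i := e ! i, j := e ! j]" using le by (simp add: nth_equalityI)
    have "e ! i \<in> {a ! i, b ! i}" "e ! j \<in> {a ! j, c ! j}"
      using nth[of i] nth[of j] ij ab(3) ac(3) l by simp_all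
    then show "e \<in> {a, b, c, d}" using eq b_eq c_eq d_eq by auto
  next
    have in_box: "a[i := p, j := q] \<in> listset ?xs" if "p \<in> {a ! i, b ! i}" "q \<in> {a ! j, c ! j}" for p q
      using that ij l ab(3) ac(3) by (auto simp: mem_listset nth_list_update)
    fix e assume "e \<in> {a, b, c, d}"
    moreover have "a \<in> listset ?xs" using in_box[of "a ! i" "a ! j"] by simp
    moreover have "b \<in> listset ?xs" using in_box[of "b ! i" "a ! j"] b_eq by simp
    moreover have "c \<in> listset ?xs" using in_box[of "a ! i" "c ! j"] c_eq by simp
    moreover have "d \<in> listset ?xs" using in_box[of "b ! i" "c ! j"] d_eq by simp
    ultimately show "e \<in> listset ?xs" by blast
  qed
  moreover have "\<forall>k<dimension G. ?xs ! k \<in> factor G k"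
    using ab ac l by (auto simp: vertices_iff nth_list_update)
  ultimately show "{a, b, c, d} \<in> cells G"
    using l unfolding cells_iff by (metis length_list_update length_map)
qed

text \<open>
  The right-hand side mentions only which sets of vertices are cells, so it is preserved by
  isomorphisms. Edges in different directions span a square, whose diagonal \<open>{b, c}\<close> moves two
  coordinates and is no cell. For edges in the same direction, the coordinates of \<open>b\<close> and \<open>c\<close> in a
  common cell lie in one simplex of the factor and span a face of it, which makes \<open>{b, c}\<close> a cell.
\<close>

lemma directions_differ_iff:
  assumes ab: "step G i a b" and ac: "step G j a c"
  shows "i \<noteq> j \<longleftrightarrow> {b, c} \<notin> cells G \<and> (\<exists>x\<in>cells G. {a, b, c} \<subseteq> x)"
proof
  assume ij: "i \<noteq> j"
  have "{a, b, c, c[i := b ! i]} \<in> cells G" unfolding square_cell_iff[OF ab ac ij] ..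
  moreover have "{a, b, c} \<subseteq> {a, b, c, c[i := b ! i]}" by simp
  moreover have "{b, c} \<notin> cells G"
  proof
    assume "{b, c} \<in> cells G"
    moreover have bc: "b ! i \<noteq> c ! i" "b ! j \<noteq> c ! j"
      using stepD(4)[OF ab] stepD(4)[OF ac] step_nth[OF ab, of j] step_nth[OF ac, of i] ij by simp_all
    then have "b \<noteq> c" by blast
    ultimately obtain k where "step G k b c" using edge_step by blast
    with bc ij show False using step_nth[of G k b c i] step_nth[of G k b c j] by metis
  qed
  ultimately show "{b, c} \<notin> cells G \<and> (\<exists>x\<in>cells G. {a, b, c} \<subseteq> x)"
    by (intro conjI bexI)
next
  assume R: "{b, c} \<notin> cells G \<and> (\<exists>x\<in>cells G. {a, b, c} \<subseteq> x)"
  then obtain x where x: "x \<in> cells G" "b \<in> x" "c \<in> x" by blast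
  show "i \<noteq> j"
  proof
    assume ij: "i = j"
    have "{b ! i, c ! i} \<in> factor G i"
      by (rule cell_coordinates[OF x(1) stepD(3)[OF ab]]) (simp, use x in blast)
    then have "(\<lambda>v. a[i := v]) ` {b ! i, c ! i} \<in> cells G"
      using line_cell_iff[OF stepD(1,3)[OF ab]] by blast
    moreover have "(\<lambda>v. a[i := v]) ` {b ! i, c ! i} = {b, c}"
      using stepD(5)[OF ab] stepD(5)[OF ac] ij by (metis image_empty image_insert)
    ultimately show False using R by simp
  qed
qed

text \<open>
  In a connected product complex any two vertices are joined by a path of edges: inside a cell one
  coordinate can be changed at a time, and consecutive cells of a chain share a vertex.
\<close>

lemma connected_induct:
  assumes G: "connected_complex G" and a: "a \<in> vertices G" "P a" and b: "b \<in> vertices G"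
    and step: "\<And>i b c. P b \<Longrightarrow> step G i b c \<Longrightarrow> P c"
  shows "P b"
proof -
  have cell: "P c" if x: "x \<in> cells G" "b \<in> x" "c \<in> x" and b: "P b" for x b c
  proof -
    have l: "length b = length c" using x cell_length by metis
    have "P (take m c @ drop m b) \<and> take m c @ drop m b \<in> x" if "m \<le> length c" for m
      using that
    proof (induction m)
      case (Suc m)
      let ?d = "take m c @ drop m b" and ?e = "take (Suc m) c @ drop (Suc m) b"
      have d: "P ?d" "?d \<in> x" using Suc by simp_all
      \<comment> \<open>Walk from \<open>b\<close> to \<open>c\<close> by replacing the first coordinates of \<open>b\<close> one after the other.\<close>
      have "?e = ?d[m := c ! m]"
        using Suc(2) l by (intro nth_equalityI) (auto simp: nth_append nth_list_update less_Suc_eq)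
      then have e: "?e \<in> x" using cell_closed_update[OF x(1) d(2) x(3)] by simp
      have "P ?e"
      proof (cases "c ! m = b ! m")
        case True
        then have "?e = ?d"
          using Suc(2) l by (intro nth_equalityI) (auto simp: nth_append less_Suc_eq)
        with d show ?thesis by simp
      next
        case False
        have V: "?d \<in> vertices G" using d(2) x(1) cell_subset_vertices by blast
        have m: "m < dimension G" using Suc(2) cell_length[OF x(1,3)] by simp
        have dm: "?d ! m = b ! m" using Suc(2) l by (simp add: nth_append)
        have "{b ! m, c ! m} \<in> factor G m"
          by (rule cell_coordinates[OF x(1) m]) (use x in auto)
        then have "step G m ?d ?e"
          unfolding step_def using V m False dm \<open>?e = ?d[m := c ! m]\<close> by metis
        then show ?thesis using step d(1) by blast
      qed
      with e show ?case by simp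
    qed (use b x in simp)
    from this[of "length c"] l show "P c" by simp
  qed
  have "({a}, {b}) \<in> (intersecting G)\<^sup>*"
    using G a(1) b by (simp add: connected_complex_def singleton_cell_iff)
  then have "\<forall>c\<in>{b}. P c"
  proof (induction rule: rtrancl_induct)
    case (step y z)
    then obtain c where "c \<in> y" "c \<in> z" "z \<in> cells G" by (auto simp: intersecting_def)
    with cell step show ?case by blast
  qed (use a in simp)
  then show ?thesis by simp
qed

definition nontrivial :: "'v simplicial_complex \<Rightarrow> bool" where
  "nontrivial S \<longleftrightarrow> (\<exists>v w. v \<noteq> w \<and> {v} \<in> simplices S \<and> {w} \<in> simplices S)"

text \<open>
  If no edge moved coordinate \<open>i\<close>, that coordinate would be constant along all paths, hence on the
  whole complex.
\<close>

lemma nontrivial_iff_step: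
  assumes G: "connected_complex G" "cells G \<noteq> {}" and i: "i < dimension G"
  shows "nontrivial (factors G ! i) \<longleftrightarrow> (\<exists>a b. step G i a b)"
proof
  assume "nontrivial (factors G ! i)"
  then obtain v w where vw: "v \<noteq> w" "{v} \<in> factor G i" "{w} \<in> factor G i"
    by (auto simp: nontrivial_def)
  obtain x where x: "x \<in> cells G" using G(2) by blast
  obtain a where a: "a \<in> vertices G"
    using x cell_nonempty[OF x] cell_subset_vertices[OF x] by blast
  have V: "a[i := v] \<in> vertices G" "a[i := w] \<in> vertices G"
    using a vw i by (auto simp: vertices_iff nth_list_update)
  show "\<exists>a b. step G i a b"
  proof (rule ccontr)
    assume no: "\<nexists>a b. step G i a b"
    have "a[i := w] ! i = v"
    proof (rule connected_induct[OF G(1) V(1) _ V(2)])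
      show "a[i := v] ! i = v" using a i by (simp add: vertices_length)
    next
      fix j b c assume b: "b ! i = v" and bc: "step G j b c"
      have "i \<noteq> j" using no bc by blast
      with b step_nth[OF bc] show "c ! i = v" by simp
    qed
    then show False using vw a i by (simp add: vertices_length)
  qed
next
  assume "\<exists>a b. step G i a b"
  then obtain a b where ab: "step G i a b" by blast
  then have "{a ! i} \<in> factor G i" "{b ! i} \<in> factor G i"
    using stepD(1-3)[OF ab] by (simp_all add: vertices_iff)
  then show "nontrivial (factors G ! i)"
    unfolding nontrivial_def using stepD(4)[OF ab] by blast
qed


section \<open>Unique factorization of connected product complexes\<close>

text \<open>
  A cell is determined by its vertices, so an isomorphism of cell posets amounts to a bijection of
  the vertices that identifies the sets of vertices forming cells.
\<close>

definition vertex_iso ::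
  "('v list \<Rightarrow> 'v list) \<Rightarrow> 'v product_complex \<Rightarrow> 'v product_complex \<Rightarrow> bool" where
  "vertex_iso \<phi> G H \<longleftrightarrow> bij_betw \<phi> (vertices G) (vertices H) \<and>
     (\<forall>x\<subseteq>vertices G. \<phi> ` x \<in> cells H \<longleftrightarrow> x \<in> cells G)"

lemma singleton_iff_minimal:
  assumes "x \<in> cells G"
  shows "is_singleton x \<longleftrightarrow> (\<forall>y\<in>cells G. y \<subseteq> x \<longrightarrow> y = x)"
proof
  assume "is_singleton x"
  then show "\<forall>y\<in>cells G. y \<subseteq> x \<longrightarrow> y = x"
    using cell_nonempty by (metis is_singleton_def subset_singletonD)
next
  assume R: "\<forall>y\<in>cells G. y \<subseteq> x \<longrightarrow> y = x"
  obtain a where a: "a \<in> x" using cell_nonempty[OF assms] by blast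
  then have "{a} \<in> cells G" using assms by (auto simp: singleton_cell_iff vertices_def)
  with R a show "is_singleton x" by (metis empty_subsetI insert_subset is_singletonI)
qed

text \<open>
  The one-vertex cells are the minimal ones, so an isomorphism of posets matches them. This
  gives the vertex map; a cell is recovered from the one-vertex cells below it.
\<close>

lemma complex_iso_imp_vertex_iso:
  assumes "complex_iso G H" shows "\<exists>\<phi>. vertex_iso \<phi> G H"
proof -
  obtain f where f: "bij_betw f (cells G) (cells H)"
    and f_mono: "\<forall>x\<in>cells G. \<forall>y\<in>cells G. f x \<subseteq> f y \<longleftrightarrow> x \<subseteq> y"
    using assms unfolding complex_iso_def by (elim exE conjE)
  note le = f_mono[rule_format]
  have fH: "f x \<in> cells H" if "x \<in> cells G" for x using bij_betwE[OF f] that by blast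
  have surj: "\<exists>x\<in>cells G. y = f x" if "y \<in> cells H" for y
    using bij_betw_imp_surj_on[OF f] that by blast
  have sing: "is_singleton (f x) \<longleftrightarrow> is_singleton x" if x: "x \<in> cells G" for x
    unfolding singleton_iff_minimal[OF x] singleton_iff_minimal[OF fH[OF x]]
  proof
    assume *: "\<forall>y\<in>cells H. y \<subseteq> f x \<longrightarrow> y = f x"
    show "\<forall>y\<in>cells G. y \<subseteq> x \<longrightarrow> y = x"
    proof (intro ballI impI)
      fix y assume y: "y \<in> cells G" "y \<subseteq> x"
      then have "f y = f x" using * fH[OF y(1)] le[OF y(1) x] by blast
      then show "y = x" using y le[OF x y(1)] by blast
    qed
  next
    assume *: "\<forall>y\<in>cells G. y \<subseteq> x \<longrightarrow> y = x"
    show "\<forall>y\<in>cells H. y \<subseteq> f x \<longrightarrow> y = f x"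
    proof (intro ballI impI)
      fix y assume y: "y \<in> cells H" "y \<subseteq> f x"
      then obtain z where z: "z \<in> cells G" "y = f z" using surj by blast
      then show "y = f x" using * y le[OF z(1) x] by blast
    qed
  qed
  define \<phi> where "\<phi> a = the_elem (f {a})" for a
  have \<phi>: "f {a} = {\<phi> a}" if "a \<in> vertices G" for a
  proof -
    have "is_singleton (f {a})" using sing[of "{a}"] that by (simp add: singleton_cell_iff)
    then show ?thesis unfolding \<phi>_def by (rule iffD1[OF is_singleton_the_elem])
  qed
  have \<phi>V: "\<phi> a \<in> vertices H" if "a \<in> vertices G" for a
    using fH[of "{a}"] \<phi>[OF that] that by (simp add: singleton_cell_iff)
  have onto: "\<exists>a\<in>vertices G. b = \<phi> a" if b: "b \<in> vertices H" for b
  proof -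
    have "{b} \<in> cells H" using b by (simp add: singleton_cell_iff)
    from surj[OF this] obtain x where x: "x \<in> cells G" "f x = {b}" by auto
    then have "is_singleton x" using sing[of x] by simp
    then obtain a where "x = {a}" by (rule is_singletonE)
    moreover from this have "a \<in> vertices G" using x(1) by (simp add: singleton_cell_iff)
    ultimately show ?thesis using x(2) \<phi>[of a] by (intro bexI[of _ a]) simp_all
  qed
  have inj: "inj_on \<phi> (vertices G)"
  proof (rule inj_onI)
    fix a b assume ab: "a \<in> vertices G" "b \<in> vertices G" "\<phi> a = \<phi> b"
    then have "f {a} \<subseteq> f {b}" using \<phi> by simp
    with le[of "{a}" "{b}"] ab(1,2) show "a = b" by (simp add: singleton_cell_iff)
  qed
  have im: "f x = \<phi> ` x" if x: "x \<in> cells G" for x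
  proof -
    have mem: "\<phi> a \<in> f x \<longleftrightarrow> a \<in> x" if "a \<in> vertices G" for a
      using le[of "{a}" x] that x \<phi>[OF that] by (simp add: singleton_cell_iff)
    show ?thesis
    proof (intro equalityI subsetI)
      fix b assume b: "b \<in> f x"
      then obtain a where "a \<in> vertices G" "b = \<phi> a"
        using onto cell_subset_vertices[OF fH[OF x]] by blast
      with mem b show "b \<in> \<phi> ` x" by blast
    qed (use mem cell_subset_vertices[OF x] in blast)
  qed
  have "\<phi> ` x \<in> cells H \<longleftrightarrow> x \<in> cells G" if x: "x \<subseteq> vertices G" for x
  proof
    assume "\<phi> ` x \<in> cells H"
    then obtain y where y: "y \<in> cells G" "\<phi> ` x = f y" using surj by blast
    then have "\<phi> ` x = \<phi> ` y" using im by simp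
    then have "x = y" using inj_on_image_eq_iff[OF inj x cell_subset_vertices[OF y(1)]] by blast
    with y show "x \<in> cells G" by simp
  next
    assume "x \<in> cells G"
    then show "\<phi> ` x \<in> cells H" using im[of x] fH[of x] by simp
  qed
  moreover have "bij_betw \<phi> (vertices G) (vertices H)"
    unfolding bij_betw_def using inj \<phi>V onto by blast
  ultimately show ?thesis unfolding vertex_iso_def by blast
qed

lemma vertex_iso_inv:
  assumes "vertex_iso \<phi> G H" shows "vertex_iso (inv_into (vertices G) \<phi>) H G"
proof -
  let ?\<psi> = "inv_into (vertices G) \<phi>"
  have bij: "bij_betw \<phi> (vertices G) (vertices H)" using assms by (simp add: vertex_iso_def)
  have "?\<psi> ` y \<in> cells G \<longleftrightarrow> y \<in> cells H" if y: "y \<subseteq> vertices H" for y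
  proof -
    have "?\<psi> ` y \<subseteq> vertices G" using y bij_betw_inv_into[OF bij] by (auto simp: bij_betw_def)
    moreover have "\<phi> ` ?\<psi> ` y = y"
      using y bij by (simp add: bij_betw_def image_inv_into_cancel)
    ultimately show ?thesis using assms unfolding vertex_iso_def by metis
  qed
  with bij_betw_inv_into[OF bij] show ?thesis by (simp add: vertex_iso_def)
qed

lemma vertex_iso_image_cell: 
  "vertex_iso \<phi> G H \<Longrightarrow> x \<in> cells G \<Longrightarrow> \<phi> ` x \<in> cells H"
  using cell_subset_vertices unfolding vertex_iso_def by blast

lemma vertex_iso_step:
  assumes "vertex_iso \<phi> G H" "step G i a b"
  shows "\<exists>k. step H k (\<phi> a) (\<phi> b)"
proof (rule edge_step)
  show "{\<phi> a, \<phi> b} \<in> cells H"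
    using vertex_iso_image_cell[OF assms(1) step_edge[OF assms(2)]] by simp
  show "\<phi> a \<noteq> \<phi> b"
    using assms(1) step_ne[OF assms(2)] stepD(1,2)[OF assms(2)]
    by (auto simp: vertex_iso_def bij_betw_def inj_on_def)
qed

lemma vertex_iso_directions:
  assumes \<phi>: "vertex_iso \<phi> G H"
    and ab: "step G i a b" "step H k (\<phi> a) (\<phi> b)"
    and ac: "step G j a c" "step H l (\<phi> a) (\<phi> c)"
  shows "i = j \<longleftrightarrow> k = l"
proof -
  have V: "a \<in> vertices G" "b \<in> vertices G" "c \<in> vertices G" using stepD ab ac by blast+
  have "\<phi> ` {b, c} \<in> cells H \<longleftrightarrow> {b, c} \<in> cells G"
    using \<phi> V unfolding vertex_iso_def by (elim conjE allE[of _ "{b, c}"]) simp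
  then have "{\<phi> b, \<phi> c} \<in> cells H \<longleftrightarrow> {b, c} \<in> cells G" by simp
  moreover have "(\<exists>y\<in>cells H. {\<phi> a, \<phi> b, \<phi> c} \<subseteq> y) \<longleftrightarrow> (\<exists>x\<in>cells G. {a, b, c} \<subseteq> x)"
  proof
    assume "\<exists>y\<in>cells H. {\<phi> a, \<phi> b, \<phi> c} \<subseteq> y"
    then obtain y where y: "y \<in> cells H" "{\<phi> a, \<phi> b, \<phi> c} \<subseteq> y" by blast
    let ?\<psi> = "inv_into (vertices G) \<phi>"
    have "?\<psi> (\<phi> d) = d" if "d \<in> vertices G" for d
      using \<phi> that by (simp add: vertex_iso_def bij_betw_def)
    then have "{a, b, c} = ?\<psi> ` {\<phi> a, \<phi> b, \<phi> c}" using V by simp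
    also have "\<dots> \<subseteq> ?\<psi> ` y" using y(2) by (rule image_mono)
    finally show "\<exists>x\<in>cells G. {a, b, c} \<subseteq> x"
      using vertex_iso_image_cell[OF vertex_iso_inv[OF \<phi>] y(1)] by (rule rev_bexI[rotated])
  next
    assume "\<exists>x\<in>cells G. {a, b, c} \<subseteq> x"
    then obtain x where x: "x \<in> cells G" "{a, b, c} \<subseteq> x" by blast
    have "{\<phi> a, \<phi> b, \<phi> c} \<subseteq> \<phi> ` x" using x(2) by simp
    then show "\<exists>y\<in>cells H. {\<phi> a, \<phi> b, \<phi> c} \<subseteq> y"
      using vertex_iso_image_cell[OF \<phi> x(1)] by (rule rev_bexI[rotated])
  qed
  ultimately show ?thesis
    using directions_differ_iff[OF ab(1) ac(1)] directions_differ_iff[OF ab(2) ac(2)] by blast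
qed

text \<open>
  If one edge in direction \<open>i\<close> at \<open>a\<close> is sent to direction \<open>k\<close>, then so is every edge in direction \<open>i\<close>
  at a neighbour \<open>c\<close> of \<open>a\<close>. When the edge from \<open>a\<close> to \<open>c\<close> has direction \<open>i\<close> itself, both ends see
  this edge. Otherwise the two edges at \<open>a\<close> span a square; its image is a square as well, and opposite
  sides of a square have the same direction.
\<close>

lemma vertex_iso_direction_transport:
  assumes \<phi>: "vertex_iso \<phi> G H"
    and ab: "step G i a b" "step H k (\<phi> a) (\<phi> b)"
    and ac: "step G j a c" and ce: "step G i c e"
  shows "step H k (\<phi> c) (\<phi> e)"
proof -
  obtain l where l: "step H l (\<phi> a) (\<phi> c)" using vertex_iso_step[OF \<phi> ac] by blast
  obtain m where m: "step H m (\<phi> c) (\<phi> e)" using vertex_iso_step[OF \<phi> ce] by blast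
  have "m = k"
  proof (cases "i = j")
    case True
    then have "k = l" using vertex_iso_directions[OF \<phi> ab ac l] by simp
    moreover have "m = l"
      using vertex_iso_directions[OF \<phi> ce m step_sym[OF ac] step_sym[OF l]] True by simp
    ultimately show ?thesis by simp
  next
    case False
    define d where "d = c[i := b ! i]"
    \<comment> \<open>\<open>d\<close> is the fourth corner of the square spanned by \<open>b\<close> and \<open>c\<close> at \<open>a\<close>.\<close>
    have cd: "step G i c d" unfolding d_def by (rule square_step[OF ab(1) ac False])
    have "{a, b, c, d} \<in> cells G" unfolding square_cell_iff[OF ab(1) ac False] d_def ..
    from vertex_iso_image_cell[OF \<phi> this] have "{\<phi> a, \<phi> b, \<phi> c, \<phi> d} \<in> cells H" by simp
    moreover have kl: "k \<noteq> l" using vertex_iso_directions[OF \<phi> ab ac l] False by simp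
    ultimately have "\<phi> d = (\<phi> c)[k := \<phi> b ! k]" using square_cell_iff[OF ab(2) l kl] by simp
    then have "step H k (\<phi> c) (\<phi> d)" using square_step[OF ab(2) l kl] by simp
    then show ?thesis using vertex_iso_directions[OF \<phi> ce m cd] by simp
  qed
  with m show ?thesis by simp
qed

text \<open>
  Transport along paths makes the image of a direction independent of the base point.
\<close>

lemma vertex_iso_direction_map:
  assumes G: "connected_complex G" and \<phi>: "vertex_iso \<phi> G H" and ab: "step G i a b"
  obtains k where "\<And>c d. step G i c d \<Longrightarrow> step H k (\<phi> c) (\<phi> d)"
proof -
  obtain k where k: "step H k (\<phi> a) (\<phi> b)" using vertex_iso_step[OF \<phi> ab] by blast
  \<comment> \<open>The existence of an edge belongs to the invariant; otherwise nothing could be transported further.\<close>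
  define P where "P c \<longleftrightarrow> (\<exists>d. step G i c d) \<and> (\<forall>d. step G i c d \<longrightarrow> step H k (\<phi> c) (\<phi> d))" for c
  have Pa: "P a"
    unfolding P_def using ab vertex_iso_step[OF \<phi>] vertex_iso_directions[OF \<phi> ab k] by metis
  have "P d" if c: "P c" and cd: "step G j c d" for j c d
  proof -
    obtain e where e: "step G i c e" "step H k (\<phi> c) (\<phi> e)" using c by (auto simp: P_def)
    have "\<exists>d'. step G i d d'" using square_step[OF e(1) cd] step_sym[OF cd] by blast
    then show ?thesis
      unfolding P_def using vertex_iso_direction_transport[OF \<phi> e cd] by blast
  qed
  then have "P c" if "c \<in> vertices G" for c
    using connected_induct[OF G stepD(1)[OF ab], of P] Pa that by blast
  then show thesis using that stepD(1) unfolding P_def by metis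
qed

text \<open>
  The copy of factor \<open>i\<close> through \<open>a\<close> is connected by edges in direction \<open>i\<close>, hence its image moves only
  coordinate \<open>k\<close> and lies in the copy of factor \<open>k\<close> through \<open>\<phi> a\<close>.
\<close>

lemma vertex_iso_factor_embedding:
  assumes G: "connected_complex G" and \<phi>: "vertex_iso \<phi> G H" and a: "a \<in> vertices G"
    and i: "i < dimension G" and k: "k < dimension H"
    and dir: "\<And>c d. step G i c d \<Longrightarrow> step H k (\<phi> c) (\<phi> d)"
  obtains \<psi> where "inj_on \<psi> (\<Union> (factor G i))" "\<And>x. x \<in> factor G i \<Longrightarrow> \<psi> ` x \<in> factor H k"
proof -
  define \<psi> where "\<psi> v = \<phi> (a[i := v]) ! k" for v
  have \<phi>a: "\<phi> a \<in> vertices H" using \<phi> a by (auto simp: vertex_iso_def bij_betw_def)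
  have la: "length a = dimension G" using a by (rule vertices_length)
  have V: "a[i := v] \<in> vertices G" if "v \<in> \<Union> (factor G i)" for v
  proof -
    have "{v} \<in> factor G i" using that simplices_props(3) by (metis UnionE empty_subsetI insert_not_empty insert_subset)
    then show ?thesis using a i by (auto simp: vertices_iff nth_list_update)
  qed
  \<comment> \<open>Along any path in \<open>G\<close>, projected to the copy of factor \<open>i\<close>, only edges in direction \<open>i\<close> survive.\<close>
  have fibre: "\<phi> (a[i := v]) = (\<phi> a)[k := \<psi> v]" if v: "v \<in> \<Union> (factor G i)" for v
  proof -
    let ?P = "\<lambda>b. \<phi> (a[i := b ! i]) = (\<phi> a)[k := \<psi> (b ! i)]"
    have "?P (a[i := v])"
    proof (rule connected_induct[OF G a, where P = ?P])
      show "?P a" by (simp add: \<psi>_def)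
    next
      fix j b c assume b: "?P b" and bc: "step G j b c"
      show "?P c"
      proof (cases "j = i")
        case True
        then have "step H k (\<phi> (a[i := b ! i])) (\<phi> (a[i := c ! i]))"
          using dir step_line[OF _ a] bc by blast
        from stepD(5)[OF this] show ?thesis unfolding b by (simp add: \<psi>_def)
      qed (use b step_nth[OF bc] in simp)
    qed (rule V[OF v])
    then show ?thesis using i la by simp
  qed
  have "inj_on \<psi> (\<Union> (factor G i))"
  proof (rule inj_onI)
    fix v w assume vw: "v \<in> \<Union> (factor G i)" "w \<in> \<Union> (factor G i)" "\<psi> v = \<psi> w"
    then have "\<phi> (a[i := v]) = \<phi> (a[i := w])" using fibre by simp
    then have "a[i := v] = a[i := w]"
      using \<phi> V vw unfolding vertex_iso_def bij_betw_def inj_on_def by blast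
    then show "v = w" using i la by (metis nth_list_update_eq)
  qed
  moreover have "\<psi> ` x \<in> factor H k" if x: "x \<in> factor G i" for x
  proof -
    have "(\<lambda>v. a[i := v]) ` x \<in> cells G" using line_cell_iff[OF a i] x by blast
    from vertex_iso_image_cell[OF \<phi> this]
    have "(\<lambda>v. \<phi> (a[i := v])) ` x \<in> cells H" by (simp add: image_image)
    also have "(\<lambda>v. \<phi> (a[i := v])) ` x = (\<lambda>w. (\<phi> a)[k := w]) ` \<psi> ` x"
      unfolding image_image by (rule image_cong) (use x fibre in auto)
    finally show ?thesis using line_cell_iff[OF \<phi>a k] by blast
  qed
  ultimately show thesis using that by blast
qed

lemma cells_of_simplicial_complex:
  "cells (of_simplicial_complex S) = (\<lambda>x. listset [x]) ` simplices S"
  by (force simp: cells_def factors_simps(1) set_Cons_def image_iff)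

text \<open>
  With the inequality of cardinalities, the injective map on simplices is onto. The detour through \<open>hd\<close> is
  needed as the cells of a one-factor product complex consist of one-element lists.
\<close>

lemma simplicial_embedding_iso:
  assumes inj: "inj_on \<psi> (\<Union> (simplices S))"
    and \<psi>: "\<And>x. x \<in> simplices S \<Longrightarrow> \<psi> ` x \<in> simplices T"
    and card: "card (simplices T) \<le> card (simplices S)"
  shows "complex_iso (of_simplicial_complex S) (of_simplicial_complex T)"
proof -
  have le: "\<psi> ` x \<subseteq> \<psi> ` y \<longleftrightarrow> x \<subseteq> y" if "x \<in> simplices S" "y \<in> simplices S" for x y
  proof
    assume *: "\<psi> ` x \<subseteq> \<psi> ` y"
    show "x \<subseteq> y"
    proof
      fix v assume v: "v \<in> x"
      with * obtain w where "w \<in> y" "\<psi> v = \<psi> w" by blast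
      moreover have "v = w" by (rule inj_onD[OF inj]) (use calculation v that in auto)
      ultimately show "v \<in> y" by simp
    qed
  qed (rule image_mono)
  have "inj_on ((`) \<psi>) (simplices S)"
    by (rule inj_onI) (use le in \<open>metis subset_antisym subset_refl\<close>)
  moreover from this have "(`) \<psi> ` simplices S = simplices T"
    using \<psi> card card_image by (intro card_seteq simplices_props(1)) fastforce+
  ultimately have bij: "bij_betw ((`) \<psi>) (simplices S) (simplices T)" by (simp add: bij_betw_def)
  have hd: "hd ` listset [x] = x" for x :: "'a set" by (force simp: set_Cons_def)
  have le1: "listset [x] \<subseteq> listset [y] \<longleftrightarrow> x \<subseteq> y" for x y :: "'a set"
    using hd by (auto simp: set_Cons_def)
  have b1: "bij_betw ((`) hd) (cells (of_simplicial_complex S)) (simplices S)" for S :: "'a simplicial_complex"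
    unfolding cells_of_simplicial_complex
    by (rule bij_betw_byWitness[where f' = "\<lambda>x. listset [x]"]) (auto simp: hd simp del: listset.simps)
  have b2: "bij_betw (\<lambda>x. listset [x]) (simplices S) (cells (of_simplicial_complex S))" for S :: "'a simplicial_complex"
    unfolding cells_of_simplicial_complex
    by (rule bij_betw_byWitness[where f' = "(`) hd"]) (auto simp: hd simp del: listset.simps)
  show ?thesis
    unfolding complex_iso_def
  proof (intro exI conjI ballI)
    show "bij_betw ((\<lambda>x. listset [x]) \<circ> ((`) \<psi> \<circ> (`) hd))
        (cells (of_simplicial_complex S)) (cells (of_simplicial_complex T))"
      by (rule bij_betw_trans[OF bij_betw_trans[OF b1 bij] b2])
  next
    fix x y assume "x \<in> cells (of_simplicial_complex S)" "y \<in> cells (of_simplicial_complex S)"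
    then obtain u w where "x = listset [u]" "u \<in> simplices S" "y = listset [w]" "w \<in> simplices S"
      unfolding cells_of_simplicial_complex by blast
    then show "((\<lambda>x. listset [x]) \<circ> ((`) \<psi> \<circ> (`) hd)) x \<subseteq> ((\<lambda>x. listset [x]) \<circ> ((`) \<psi> \<circ> (`) hd)) y
        \<longleftrightarrow> x \<subseteq> y"
      by (simp add: hd le le1 del: listset.simps)
  qed
qed

lemma vertex_iso_intersecting:
  assumes \<phi>: "vertex_iso \<phi> G H"
  shows "(x, x') \<in> (intersecting G)\<^sup>* \<Longrightarrow> (\<phi> ` x, \<phi> ` x') \<in> (intersecting H)\<^sup>*"
proof (induction rule: rtrancl_induct)
  case (step u w)
  then have "(\<phi> ` u, \<phi> ` w) \<in> intersecting H"
    using vertex_iso_image_cell[OF \<phi>] by (auto simp: intersecting_def)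
  with step show ?case by simp
qed simp

lemma vertex_iso_image_inv:
  assumes "vertex_iso \<phi> G H" "y \<in> cells H"
  shows "\<phi> ` inv_into (vertices G) \<phi> ` y = y"
  using assms(1) cell_subset_vertices[OF assms(2)]
  by (simp add: vertex_iso_def bij_betw_def image_inv_into_cancel)

lemma connected_iso:
  assumes \<phi>: "vertex_iso \<phi> G H" and G: "connected_complex G"
  shows "connected_complex H"
  unfolding connected_complex_def
proof (intro ballI)
  fix y y' assume y: "y \<in> cells H" "y' \<in> cells H"
  let ?\<psi> = "inv_into (vertices G) \<phi>"
  have "?\<psi> ` y \<in> cells G" "?\<psi> ` y' \<in> cells G"
    using vertex_iso_image_cell[OF vertex_iso_inv[OF \<phi>]] y by blast+
  then have "(?\<psi> ` y, ?\<psi> ` y') \<in> (intersecting G)\<^sup>*"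
    using G unfolding connected_complex_def by blast
  from vertex_iso_intersecting[OF \<phi> this] show "(y, y') \<in> (intersecting H)\<^sup>*"
    using vertex_iso_image_inv[OF \<phi>] y by simp
qed

lemma filter_conv_mset_set:
  "mset (filter P xs) = image_mset (\<lambda>i. xs ! i) (mset_set {i. i < length xs \<and> P (xs ! i)})"
proof -
  have "mset xs = image_mset (\<lambda>i. xs ! i) (mset_set {..<length xs})"
    by (metis map_nth mset_map mset_set_upto_eq_mset_upto)
  then have "mset (filter P xs) = filter_mset P (image_mset (\<lambda>i. xs ! i) (mset_set {..<length xs}))"
    by (metis mset_filter)
  also have "\<dots> = image_mset (\<lambda>i. xs ! i) (mset_set {i. i < length xs \<and> P (xs ! i)})"
    by (simp add: filter_mset_image_mset)
  finally show ?thesis .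
qed

text \<open>
  The directions in which edges exist are the factors with at least two vertices. The isomorphism and
  its inverse induce mutually inverse maps \<open>\<sigma>\<close> and \<open>\<tau>\<close> between the directions of \<open>G\<close> and of \<open>H\<close>.
  Factor \<open>i\<close> of \<open>G\<close> embeds into factor \<open>\<sigma> i\<close> of \<open>H\<close> and conversely, so both are isomorphic by finiteness.
  The function \<open>c\<close> stands for any invariant of simplicial complexes.
\<close>

lemma factors_unique:
  assumes iso: "complex_iso G H" and G: "connected_complex G" "cells G \<noteq> {}"
    and c: "\<And>S T. complex_iso (of_simplicial_complex S) (of_simplicial_complex T) \<Longrightarrow> c S = c T"
  shows "image_mset c (mset (filter nontrivial (factors G))) =
         image_mset c (mset (filter nontrivial (factors H)))"
proof -
  obtain \<phi> where \<phi>: "vertex_iso \<phi> G H" using complex_iso_imp_vertex_iso[OF iso] by blast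
  define \<phi>' where "\<phi>' = inv_into (vertices G) \<phi>"
  have \<phi>': "vertex_iso \<phi>' H G" unfolding \<phi>'_def by (rule vertex_iso_inv[OF \<phi>])
  have inv: "\<phi>' (\<phi> a) = a" if "a \<in> vertices G" for a
    using \<phi> that by (simp add: \<phi>'_def vertex_iso_def bij_betw_def)
  have inv': "\<phi> (\<phi>' b) = b" if "b \<in> vertices H" for b
    using \<phi> that by (simp add: \<phi>'_def vertex_iso_def bij_betw_def f_inv_into_f)
  have H: "connected_complex H" by (rule connected_iso[OF \<phi> G(1)])
  have H': "cells H \<noteq> {}" using G(2) vertex_iso_image_cell[OF \<phi>] by blast
  define I where "I G = {i. i < dimension G \<and> nontrivial (factors G ! i)}" for G :: "'a product_complex"
  have I_iff: "i \<in> I G \<longleftrightarrow> (\<exists>a b. step G i a b)" if "connected_complex G" "cells G \<noteq> {}" for G :: "'a product_complex" and i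
    unfolding I_def using nontrivial_iff_step[OF that] stepD(3) by blast
  have "\<forall>i. \<exists>k. i \<in> I G \<longrightarrow> (\<forall>c d. step G i c d \<longrightarrow> step H k (\<phi> c) (\<phi> d))"
    using vertex_iso_direction_map[OF G(1) \<phi>] I_iff[OF G] by metis
  then obtain \<sigma> where \<sigma>: "\<And>i c d. i \<in> I G \<Longrightarrow> step G i c d \<Longrightarrow> step H (\<sigma> i) (\<phi> c) (\<phi> d)"
    by metis
  have "\<forall>k. \<exists>i. k \<in> I H \<longrightarrow> (\<forall>c d. step H k c d \<longrightarrow> step G i (\<phi>' c) (\<phi>' d))"
    using vertex_iso_direction_map[OF H \<phi>'] I_iff[OF H H'] by metis
  then obtain \<tau> where \<tau>: "\<And>k c d. k \<in> I H \<Longrightarrow> step H k c d \<Longrightarrow> step G (\<tau> k) (\<phi>' c) (\<phi>' d)"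
    by metis
  have \<sigma>I: "\<sigma> i \<in> I H \<and> \<tau> (\<sigma> i) = i" if i: "i \<in> I G" for i
  proof -
    obtain a b where ab: "step G i a b" using i I_iff[OF G] by blast
    then have s: "step H (\<sigma> i) (\<phi> a) (\<phi> b)" using \<sigma> i by blast
    then have "\<sigma> i \<in> I H" using I_iff[OF H H'] by blast
    with \<tau>[OF this s] ab inv stepD(1,2)[OF ab] step_unique show ?thesis by metis
  qed
  have \<tau>I: "\<tau> k \<in> I G \<and> \<sigma> (\<tau> k) = k" if k: "k \<in> I H" for k
  proof -
    obtain a b where ab: "step H k a b" using k I_iff[OF H H'] by blast
    then have s: "step G (\<tau> k) (\<phi>' a) (\<phi>' b)" using \<tau> k by blast
    then have "\<tau> k \<in> I G" using I_iff[OF G] by blast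
    with \<sigma>[OF this s] ab inv' stepD(1,2)[OF ab] step_unique show ?thesis by metis
  qed
  have bij: "bij_betw \<sigma> (I G) (I H)"
    by (rule bij_betw_byWitness[where f' = \<tau>]) (use \<sigma>I \<tau>I in auto)
  have c_eq: "c (factors G ! i) = c (factors H ! \<sigma> i)" if i: "i \<in> I G" for i
  proof (rule c)
    obtain a b where ab: "step G i a b" using i I_iff[OF G] by blast
    have s: "step H (\<sigma> i) (\<phi> a) (\<phi> b)" using \<sigma> i ab by blast
    obtain \<psi> where \<psi>: "inj_on \<psi> (\<Union> (factor G i))" "\<And>x. x \<in> factor G i \<Longrightarrow> \<psi> ` x \<in> factor H (\<sigma> i)"
      using vertex_iso_factor_embedding[OF G(1) \<phi> stepD(1,3)[OF ab] stepD(3)[OF s] \<sigma>[OF i]] by blast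
    obtain \<psi>' where \<psi>': "inj_on \<psi>' (\<Union> (factor H (\<sigma> i)))" "\<And>x. x \<in> factor H (\<sigma> i) \<Longrightarrow> \<psi>' ` x \<in> factor G i"
      using vertex_iso_factor_embedding[OF H \<phi>' stepD(1,3)[OF s] stepD(3)[OF ab]] \<tau> \<sigma>I[OF i] by metis
    have "inj_on ((`) \<psi>') (factor H (\<sigma> i))"
      by (rule inj_onI) (use inj_on_image_eq_iff[OF \<psi>'(1)] in blast)
    then have "card (factor H (\<sigma> i)) \<le> card (factor G i)"
      by (rule card_inj_on_le) (use \<psi>'(2) simplices_props(1) in auto)
    with \<psi> show "complex_iso (of_simplicial_complex (factors G ! i)) (of_simplicial_complex (factors H ! \<sigma> i))"
      by (rule simplicial_embedding_iso)
  qed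
  have "image_mset c (mset (filter nontrivial (factors G))) = image_mset (\<lambda>i. c (factors G ! i)) (mset_set (I G))" for G
    unfolding filter_conv_mset_set I_def dimension_def by (simp add: image_mset.compositionality comp_def)
  moreover have "image_mset (\<lambda>i. c (factors G ! i)) (mset_set (I G)) =
      image_mset (\<lambda>k. c (factors H ! k)) (image_mset \<sigma> (mset_set (I G)))"
    unfolding image_mset.compositionality by (rule image_mset_cong) (auto simp: c_eq I_def)
  moreover have "image_mset \<sigma> (mset_set (I G)) = mset_set (I H)"
    using bij by (simp add: bij_betw_def image_mset_mset_set)
  ultimately show ?thesis by metis
qed


section \<open>Divisors of monomials in a polynomial ring\<close>

lemma lookup_mult_unique_sum:
  fixes p q :: "'a::cancel_comm_monoid_add \<Rightarrow>\<^sub>0 'b::comm_ring_1"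
  assumes P: "P \<in> Poly_Mapping.keys p" and Q: "Q \<in> Poly_Mapping.keys q"
    and unique: "\<And>a b. a \<in> Poly_Mapping.keys p \<Longrightarrow> b \<in> Poly_Mapping.keys q \<Longrightarrow>
      a + b = P + Q \<Longrightarrow> a = P"
  shows "Poly_Mapping.lookup (p * q) (P + Q) = Poly_Mapping.lookup p P * Poly_Mapping.lookup q Q"
proof -
  define c d where "c = Poly_Mapping.lookup p P" and "d = Poly_Mapping.lookup q Q"
  define p' q' where "p' = p - Poly_Mapping.single P c" and "q' = q - Poly_Mapping.single Q d"
  have lp: "Poly_Mapping.lookup p' k = (if k = P then 0 else Poly_Mapping.lookup p k)" for k
    by (simp add: p'_def c_def lookup_minus lookup_single when_def)
  have lq: "Poly_Mapping.lookup q' k = (if k = Q then 0 else Poly_Mapping.lookup q k)" for k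
    by (simp add: q'_def d_def lookup_minus lookup_single when_def)
  have kp: "a \<in> Poly_Mapping.keys p' \<Longrightarrow> a \<in> Poly_Mapping.keys p \<and> a \<noteq> P" for a
    by (simp add: in_keys_iff lp split: if_splits)
  have kq: "a \<in> Poly_Mapping.keys q' \<Longrightarrow> a \<noteq> Q" for a
    by (simp add: in_keys_iff lq split: if_splits)
  have "P + Q \<notin> Poly_Mapping.keys (p' * q)"
  proof
    assume "P + Q \<in> Poly_Mapping.keys (p' * q)"
    then obtain a b where ab: "P + Q = a + b" "a \<in> Poly_Mapping.keys p'" "b \<in> Poly_Mapping.keys q"
      using keys_mult[of p' q] by blast
    then show False using kp[OF ab(2)] unique[of a b] by simp
  qed
  moreover have "P + Q \<notin> Poly_Mapping.keys (Poly_Mapping.single P c * q')"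
  proof
    assume "P + Q \<in> Poly_Mapping.keys (Poly_Mapping.single P c * q')"
    then obtain a b where "P + Q = a + b" "a \<in> Poly_Mapping.keys (Poly_Mapping.single P c)"
      "b \<in> Poly_Mapping.keys q'"
      using keys_mult[of "Poly_Mapping.single P c" q'] by blast
    then show False using kq by (auto split: if_splits)
  qed
  moreover have "p * q = p' * q + (Poly_Mapping.single P c * q' + Poly_Mapping.single (P + Q) (c * d))"
    unfolding p'_def q'_def mult_single[symmetric] by (simp only: left_diff_distrib right_diff_distrib) simp
  ultimately show ?thesis
    by (simp add: lookup_add in_keys_iff c_def d_def)
qed

text \<open>
  The multiset extension of a linear order on the elements is translation-invariant, so the monomials
  in arbitrarily many variables carry a monomial order.
\<close>

lemma strict_order_on_multisets_exists:
  obtains R :: "'a multiset \<Rightarrow> 'a multiset \<Rightarrow> bool"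
  where "transp R" "totalp R" "\<And>a. \<not> R a a" "\<And>a b c. R a b \<Longrightarrow> R (a + c) (b + c)"
proof -
  obtain r :: "'a rel" where "well_order_on UNIV r" using well_order_on[of UNIV] by blast
  then have lin: "linear_order_on UNIV r" by (simp add: well_order_on_def)
  define s where "s = r - Id"
  have tr: "trans s" and irr: "irrefl s" and tot: "total s"
    using lin unfolding s_def linear_order_on_def partial_order_on_def preorder_on_def
    by (auto intro: trans_diff_Id simp: irrefl_def)
  show thesis
  proof (rule that[of "\<lambda>a b. (a, b) \<in> mult s"])
    show "transp (\<lambda>a b. (a, b) \<in> mult s)" using trans_mult[OF tr] by (auto simp: transp_def dest: transD)
    show "totalp (\<lambda>a b. (a, b) \<in> mult s)"
      using total_mult[OF tot tr] by (auto simp: totalp_on_def total_on_def)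
    show "(a, a) \<notin> mult s" for a using irrefl_mult[OF tr irr] by (simp add: irrefl_def)
    show "(a + c, b + c) \<in> mult s" if "(a, b) \<in> mult s" for a b c
      using that mult_cancel[OF tr, of c] irr by (auto simp: irrefl_on_def)
  qed
qed

text \<open>
  Multisets serve as exponents of monomials. The product of the leading terms of \<open>p\<close> and \<open>q\<close> and the
  product of their lowest terms both survive in \<open>p * q\<close>. If this is a single term, the leading and the
  lowest term coincide in \<open>p\<close> as well as in \<open>q\<close>.
\<close>

lemma factors_of_single:
  fixes p q :: "'a multiset \<Rightarrow>\<^sub>0 'b::idom"
  assumes pq: "p * q = Poly_Mapping.single m c" and c: "c \<noteq> 0"
  obtains m1 c1 m2 c2 where "p = Poly_Mapping.single m1 c1" "q = Poly_Mapping.single m2 c2"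
    "m = m1 + m2" "c = c1 * c2"
proof -
  let ?K = Poly_Mapping.keys
  obtain R :: "'a multiset \<Rightarrow> 'a multiset \<Rightarrow> bool" where R: "transp R" "totalp R" "\<And>a. \<not> R a a"
    and add: "\<And>a b c. R a b \<Longrightarrow> R (a + c) (b + c)"
    using strict_order_on_multisets_exists by metis
  have mono: "R (a + b) (a' + b')" if "a = a' \<or> R a a'" "b = b' \<or> R b b'" "a \<noteq> a' \<or> b \<noteq> b'" for a a' b b'
  proof -
    have "R (a + b) (a' + b)" if "R a a'" using add that by blast
    moreover have "R (a' + b) (a' + b')" if "R b b'" using add[OF that, of a'] by (simp add: add.commute)
    ultimately show ?thesis using that transpD[OF R(1), of "a + b" "a' + b" "a' + b'"] by auto
  qed
  have "p \<noteq> 0" "q \<noteq> 0" using pq c by (auto dest: arg_cong[of _ _ "\<lambda>f. Poly_Mapping.lookup f m"])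
  then have ne: "?K p \<noteq> {}" "?K q \<noteq> {}" by simp_all
  have tr: "transp_on A R" and tot: "totalp_on A R" for A
    using R(1,2) by (auto intro: transp_on_subset totalp_on_subset)
  obtain P where P: "P \<in> ?K p" "\<forall>x\<in>?K p. x \<noteq> P \<longrightarrow> R x P"
    using Finite_Set.bex_greatest_element[OF finite_keys ne(1) tr tot] by blast
  obtain Q where Q: "Q \<in> ?K q" "\<forall>x\<in>?K q. x \<noteq> Q \<longrightarrow> R x Q"
    using Finite_Set.bex_greatest_element[OF finite_keys ne(2) tr tot] by blast
  obtain P' where P': "P' \<in> ?K p" "\<forall>x\<in>?K p. x \<noteq> P' \<longrightarrow> R P' x"
    using Finite_Set.bex_least_element[OF finite_keys ne(1) tr tot] by blast
  obtain Q' where Q': "Q' \<in> ?K q" "\<forall>x\<in>?K q. x \<noteq> Q' \<longrightarrow> R Q' x"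
    using Finite_Set.bex_least_element[OF finite_keys ne(2) tr tot] by blast
  have top: "Poly_Mapping.lookup (p * q) (P + Q) = Poly_Mapping.lookup p P * Poly_Mapping.lookup q Q"
  proof (rule lookup_mult_unique_sum[OF P(1) Q(1)])
    fix a b assume "a \<in> ?K p" "b \<in> ?K q" "a + b = P + Q"
    then show "a = P" using mono[of a P b Q] P(2) Q(2) R(3)[of "P + Q"] by auto
  qed
  have bot: "Poly_Mapping.lookup (p * q) (P' + Q') = Poly_Mapping.lookup p P' * Poly_Mapping.lookup q Q'"
  proof (rule lookup_mult_unique_sum[OF P'(1) Q'(1)])
    fix a b assume "a \<in> ?K p" "b \<in> ?K q" "a + b = P' + Q'"
    then show "a = P'" using mono[of P' a Q' b] P'(2) Q'(2) R(3)[of "P' + Q'"] by metis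
  qed
  have "Poly_Mapping.lookup (p * q) (P + Q) \<noteq> 0" "Poly_Mapping.lookup (p * q) (P' + Q') \<noteq> 0"
    using P(1) Q(1) P'(1) Q'(1) by (simp_all add: top bot in_keys_iff)
  then have m: "P + Q = m" "P' + Q' = m" unfolding pq by (auto simp: lookup_single when_def split: if_splits)
  then have eq: "P' = P" "Q' = Q"
    using mono[of P' P Q' Q] P(1) Q(1) P'(2) Q'(2) R(3)[of m] by metis+
  have "x = P" if "x \<in> ?K p" for x
    using that P(2) P'(2) transpD[OF R(1), of x P x] R(3)[of x] unfolding eq by blast
  moreover have "x = Q" if "x \<in> ?K q" for x
    using that Q(2) Q'(2) transpD[OF R(1), of x Q x] R(3)[of x] unfolding eq by blast
  ultimately have pP: "?K p \<subseteq> {P}" "?K q \<subseteq> {Q}" by auto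
  have single: "f = Poly_Mapping.single k (Poly_Mapping.lookup f k)" if "?K f \<subseteq> {k}"
    for f :: "'a multiset \<Rightarrow>\<^sub>0 'b" and k
    using that by (intro poly_mapping_eqI) (auto simp: lookup_single when_def in_keys_iff subset_iff)
  show thesis
  proof (rule that[OF single[OF pP(1)] single[OF pP(2)]])
    show "m = P + Q" using m by simp
    show "c = Poly_Mapping.lookup p P * Poly_Mapping.lookup q Q"
      using top m unfolding pq by simp
  qed
qed

text \<open>
  Polynomials with integer coefficients whose variables are ring elements are evaluated at these very
  elements.
\<close>

definition evaluate :: "('r::comm_ring_1 multiset \<Rightarrow>\<^sub>0 int) \<Rightarrow> 'r" where
  "evaluate p = (\<Sum>m\<in>Poly_Mapping.keys p. of_int (Poly_Mapping.lookup p m) * prod_mset m)"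

lemma evaluate_add: "evaluate (p + q) = evaluate p + evaluate q"
  unfolding evaluate_def by (rule setsum_keys_plus_distrib) (simp_all add: distrib_right)

lemma evaluate_0: "evaluate 0 = 0"
  by (simp add: evaluate_def)

lemma evaluate_uminus: "evaluate (- p) = - evaluate p"
  using evaluate_add[of "- p" p] by (simp add: evaluate_0 eq_neg_iff_add_eq_0)

lemma evaluate_single: "evaluate (Poly_Mapping.single m c) = of_int c * prod_mset m"
  by (simp add: evaluate_def)


section \<open>Classes of connected product complexes\<close>

lemma complex_class_iso: "complex_iso G H \<Longrightarrow> complex_class G = complex_class H"
  by transfer (rule sc_equiv.iso)

lemma complex_class_times: "complex_class (complex_times G H) = complex_class G * complex_class H"
  by transfer (simp add: sc_equiv.refl)

lemma complex_class_K1: "complex_class K1 = 1"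
  by transfer (rule sc_equiv.refl)

lemma complex_iso_K1:
  assumes "card (cells G) = 1" shows "complex_iso G K1"
proof -
  obtain x where x: "cells G = {x}" using assms by (rule card_1_singletonE)
  show ?thesis
    unfolding complex_iso_def x cells_K1
    by (rule exI[of _ "\<lambda>_. {[undefined]}"]) (simp add: bij_betw_def)
qed

text \<open>
  The signed number of cells is an invariant of ring elements, so a complex with class 1 has exactly
  one cell.
\<close>

lemma complex_class_eq_1_iff: "complex_class G = 1 \<longleftrightarrow> complex_iso G K1"
proof
  assume "complex_class G = 1"
  then have "sc_equiv {#(1, G)#} {#(1, K1)#}" by transfer
  from sc_size_cong[OF this] have "card (cells G) = 1"
    by (simp add: sc_size_def one_sign.rep_eq cells_K1)
  then show "complex_iso G K1" by (rule complex_iso_K1)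
qed (use complex_class_iso complex_class_K1 in metis)

definition simplex_class :: "'v simplicial_complex \<Rightarrow> 'v strong_ring" where
  "simplex_class S = complex_class (of_simplicial_complex S)"

text \<open>
  A non-empty complex without two different vertices is a point.
\<close>

lemma simplex_class_trivial:
  assumes "\<not> nontrivial S" "simplices S \<noteq> {}"
  shows "simplex_class S = 1"
proof -
  have sub: "{v} \<in> simplices S" if "x \<in> simplices S" "v \<in> x" for x v
    using simplices_props(3)[OF that(1), of "{v}"] that(2) by simp
  obtain x where x: "x \<in> simplices S" using assms(2) by blast
  obtain v where v: "v \<in> x" using simplices_props(2)[OF x] by blast
  have "y = {v}" if y: "y \<in> simplices S" for y
  proof -
    have "w = v" if "w \<in> y" for w
      using assms(1) sub[OF y that] sub[OF x v] unfolding nontrivial_def by metis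
    then show ?thesis using simplices_props(2)[OF y] by blast
  qed
  then have "simplices S = {{v}}" using x by auto
  then have "card (cells (of_simplicial_complex S)) = 1" by (simp add: cells_of_simplicial_complex)
  then show ?thesis
    unfolding simplex_class_def complex_class_eq_1_iff by (rule complex_iso_K1)
qed

lemma connected_timesD:
  assumes GH: "connected_complex (complex_times G H)" and ne: "cells (complex_times G H) \<noteq> {}"
  shows "connected_complex G" "connected_complex H"
proof -
  obtain x0 y0 where 0: "x0 \<in> cells G" "y0 \<in> cells H" using ne by (auto simp: cells_times)
  have *: "(x, x') \<in> (intersecting G)\<^sup>* \<and> (y, y') \<in> (intersecting H)\<^sup>*"
    if cs: "x \<in> cells G" "x' \<in> cells G" "y \<in> cells H" "y' \<in> cells H" for x x' y y'
  proof -
    have "(cell_times x y, cell_times x' y') \<in> (intersecting (complex_times G H))\<^sup>*"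
      using GH cs unfolding connected_complex_def cells_times by blast
    then obtain u w where uw: "cell_times x' y' = cell_times u w" "(x, u) \<in> (intersecting G)\<^sup>*"
      "(y, w) \<in> (intersecting H)\<^sup>*"
      using rtrancl_intersecting_times[OF cs(1,3)] by blast
    have "x' = u \<and> y' = w"
      using uw(1) cell_times_eq_iff[OF cs(2) rtrancl_intersecting_cells[OF uw(2) cs(1)]
          cs(4) rtrancl_intersecting_cells[OF uw(3) cs(3)]] by simp
    then show ?thesis using uw by simp
  qed
  show "connected_complex G" "connected_complex H"
    unfolding connected_complex_def using * 0 by blast+
qed

lemma product_complex_induct:
  assumes "\<And>S. P (of_simplicial_complex S)"
    and "\<And>S G. P G \<Longrightarrow> P (complex_times (of_simplicial_complex S) G)"
  shows "P G"
proof (induction "factors G" arbitrary: G)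
  case Nil
  then show ?case using factors_nonempty[of G] by simp
next
  case (Cons S Ss)
  show ?case
  proof (cases "Ss = []")
    case True
    then have "G = of_simplicial_complex S"
      using Cons(2) by (metis factors_inject factors_simps(1))
    with assms(1) show ?thesis by simp
  next
    case False
    define G' where "G' = Product_complex Ss"
    have G': "factors G' = Ss" using False by (simp add: G'_def Product_complex_inverse)
    have "factors G = factors (complex_times (of_simplicial_complex S) G')"
      using Cons(2) G' by simp
    then have "G = complex_times (of_simplicial_complex S) G'" by (rule iffD1[OF factors_inject])
    with assms(2) Cons(1)[OF G'[symmetric]] show ?thesis by simp
  qed
qed

text \<open>
  One-point factors have class 1 and are dropped; the remaining ones are recorded by their
  classes. For a connected product complex this is the exponent of the monomial representing it.
\<close>

definition simplicial_factors :: "'v product_complex \<Rightarrow> 'v strong_ring multiset" where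
  "simplicial_factors G = image_mset simplex_class (mset (filter nontrivial (factors G)))"

lemma simplicial_factors_times:
  "simplicial_factors (complex_times G H) = simplicial_factors G + simplicial_factors H"
  by (simp add: simplicial_factors_def)

lemma simplicial_factors_iso:
  "complex_iso G H \<Longrightarrow> connected_complex G \<Longrightarrow> cells G \<noteq> {} \<Longrightarrow>
    simplicial_factors G = simplicial_factors H"
  unfolding simplicial_factors_def
  by (rule factors_unique) (simp_all add: simplex_class_def complex_class_iso)

definition generators :: "'v strong_ring set" where
  "generators = {simplex_class S |S. connected_complex (of_simplicial_complex S) \<and> nontrivial S}"

lemma complex_class_factorization:
  assumes "connected_complex G" "cells G \<noteq> {}"
  shows "complex_class G = prod_mset (simplicial_factors G) \<and> set_mset (simplicial_factors G) \<subseteq> generators"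
  using assms
proof (induction G rule: product_complex_induct)
  case (1 S)
  then have "simplices S \<noteq> {}" by (simp add: cells_of_simplicial_complex)
  with 1 simplex_class_trivial[of S] show ?case
    by (auto simp: simplicial_factors_def simplex_class_def generators_def)
next
  case (2 S G)
  have "complex_class (of_simplicial_complex S) = prod_mset (simplicial_factors (of_simplicial_complex S)) \<and>
    set_mset (simplicial_factors (of_simplicial_complex S)) \<subseteq> generators"
  proof -
    have "connected_complex (of_simplicial_complex S)" "simplices S \<noteq> {}"
      using connected_timesD(1)[OF 2(2,3)] 2(3) by (auto simp: cells_times cells_of_simplicial_complex)
    with simplex_class_trivial[of S] show ?thesis
      by (auto simp: simplicial_factors_def simplex_class_def generators_def)
  qed
  moreover have "complex_class G = prod_mset (simplicial_factors G) \<and> set_mset (simplicial_factors G) \<subseteq> generators"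
    using 2(1) connected_timesD(2)[OF 2(2,3)] 2(3) by (auto simp: cells_times)
  ultimately show ?case by (simp add: complex_class_times simplicial_factors_times)
qed

lemma conn_components_image: "conn_components G = (\<lambda>x. (intersecting G)\<^sup>* `` {x}) ` cells G"
  by (auto simp: conn_components_def quotient_def)

lemma connected_iff_components:
  "connected_complex G \<and> cells G \<noteq> {} \<longleftrightarrow> conn_components G = {cells G}"
proof
  assume G: "connected_complex G \<and> cells G \<noteq> {}"
  have "(intersecting G)\<^sup>* `` {x} = cells G" if x: "x \<in> cells G" for x
  proof (intro equalityI subsetI)
    fix y assume "y \<in> (intersecting G)\<^sup>* `` {x}"
    then show "y \<in> cells G" using rtrancl_intersecting_cells[of x y G] x by simp
  qed (use G x in \<open>simp add: connected_complex_def\<close>)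
  then have "conn_components G = (\<lambda>_. cells G) ` cells G"
    unfolding conn_components_image by (rule image_cong[OF HOL.refl])
  with G show "conn_components G = {cells G}" by auto
next
  assume L: "conn_components G = {cells G}"
  have "connected_complex G"
    unfolding connected_complex_def
  proof (intro ballI)
    fix x y assume xy: "x \<in> cells G" "y \<in> cells G"
    then have "(intersecting G)\<^sup>* `` {x} \<in> {cells G}" unfolding L[symmetric] conn_components_image by simp
    with xy(2) show "(x, y) \<in> (intersecting G)\<^sup>*" by auto
  qed
  moreover have "cells G \<noteq> {}" using component_nonempty[of "cells G" G] L by simp
  ultimately show "connected_complex G \<and> cells G \<noteq> {}" by simp
qed

lemma component_connected:
  assumes "cells H \<in> conn_components G"
  shows "connected_complex H" "cells H \<noteq> {}"
  using iffD2[OF connected_iff_components components_of_component[OF assms]] by simp_all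


section \<open>The strong ring as a polynomial ring\<close>

text \<open>
  Components are given as sets of cells. The choice of a product complex with these cells does not
  matter, since any two choices are isomorphic.
\<close>

definition component_monomial :: "'v list set set \<Rightarrow> 'v strong_ring multiset \<Rightarrow>\<^sub>0 int" where
  "component_monomial C = Poly_Mapping.single (simplicial_factors (SOME H. cells H = C)) 1"

definition complex_expansion :: "'v product_complex \<Rightarrow> 'v strong_ring multiset \<Rightarrow>\<^sub>0 int" where
  "complex_expansion G = (\<Sum>C\<in>conn_components G. component_monomial C)"

lemma component_monomial_cells:
  assumes "connected_complex H" "cells H \<noteq> {}"
  shows "component_monomial (cells H) = Poly_Mapping.single (simplicial_factors H) 1"
proof -
  define H' where "H' = (SOME H'. cells H' = cells H)"
  have "cells H' = cells H" unfolding H'_def by (rule someI[of _ H]) simp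
  then have "complex_iso H H'" unfolding complex_iso_def by (intro exI[of _ id]) simp
  from simplicial_factors_iso[OF this assms] show ?thesis
    by (simp add: component_monomial_def H'_def)
qed

lemma complex_expansion_connected:
  assumes "connected_complex G" "cells G \<noteq> {}"
  shows "complex_expansion G = Poly_Mapping.single (simplicial_factors G) 1"
  using connected_iff_components[of G] component_monomial_cells[OF assms] assms
  by (simp add: complex_expansion_def)

lemma complex_expansion_split:
  assumes "image_mset cells Hs = mset_set (conn_components G)"
  shows "complex_expansion G = (\<Sum>H\<in>#Hs. complex_expansion H)"
proof -
  have "complex_expansion H = component_monomial (cells H)" if "H \<in># Hs" for H
  proof -
    have "cells H \<in># mset_set (conn_components G)" unfolding assms[symmetric] using that by simp
    then have "cells H \<in> conn_components G" by simp
    note H = component_connected[OF this]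
    show ?thesis using complex_expansion_connected[OF H] component_monomial_cells[OF H] by simp
  qed
  then have "(\<Sum>H\<in>#Hs. complex_expansion H) = (\<Sum>H\<in>#Hs. component_monomial (cells H))"
    by (intro arg_cong[where f = sum_mset] image_mset_cong)
  also have "\<dots> = (\<Sum>C\<in>#image_mset cells Hs. component_monomial C)"
    by (simp add: image_mset.compositionality comp_def)
  finally show ?thesis by (simp add: assms complex_expansion_def sum_unfold_sum_mset)
qed

text \<open>
  The vertex bijection maps the connected components of \<open>G\<close> onto those of \<open>H\<close>, and restricts to an
  isomorphism between corresponding components, which therefore have the same factors.
\<close>

lemma complex_expansion_iso:
  assumes "complex_iso G H" shows "complex_expansion G = complex_expansion H"
proof -
  obtain \<phi> where \<phi>: "vertex_iso \<phi> G H" using complex_iso_imp_vertex_iso[OF assms] by blast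
  let ?\<psi> = "inv_into (vertices G) \<phi>"
  have \<psi>: "vertex_iso ?\<psi> H G" by (rule vertex_iso_inv[OF \<phi>])
  have inj: "inj_on \<phi> (vertices G)" using \<phi> by (simp add: vertex_iso_def bij_betw_def)
  have inj_im: "\<phi> ` x = \<phi> ` y \<longleftrightarrow> x = y" if "x \<in> cells G" "y \<in> cells G" for x y
    by (rule inj_on_image_eq_iff[OF inj cell_subset_vertices cell_subset_vertices]) (fact that)+
  have le_im: "\<phi> ` x \<subseteq> \<phi> ` y \<longleftrightarrow> x \<subseteq> y" if xy: "x \<in> cells G" "y \<in> cells G" for x y
  proof
    assume *: "\<phi> ` x \<subseteq> \<phi> ` y"
    show "x \<subseteq> y"
    proof
      fix a assume a: "a \<in> x"
      with * obtain b where "b \<in> y" "\<phi> a = \<phi> b" by blast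
      moreover have "a = b"
        by (rule inj_onD[OF inj]) (use calculation a xy cell_subset_vertices in blast)+
      ultimately show "a \<in> y" by simp
    qed
  qed (rule image_mono)
  have \<psi>\<phi>: "?\<psi> ` \<phi> ` x = x" if "x \<in> cells G" for x
    by (rule inv_into_image_cancel[OF inj cell_subset_vertices[OF that]])
  have comp: "(intersecting H)\<^sup>* `` {\<phi> ` x} = (`) \<phi> ` ((intersecting G)\<^sup>* `` {x})"
    if x: "x \<in> cells G" for x
  proof (intro equalityI subsetI)
    fix y assume y: "y \<in> (intersecting H)\<^sup>* `` {\<phi> ` x}"
    have yH: "y \<in> cells H"
      using y rtrancl_intersecting_cells vertex_iso_image_cell[OF \<phi> x] by blast
    have "(\<phi> ` x, y) \<in> (intersecting H)\<^sup>*" using y by simp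
    from vertex_iso_intersecting[OF \<psi> this] have "?\<psi> ` y \<in> (intersecting G)\<^sup>* `` {x}"
      using \<psi>\<phi>[OF x] by simp
    then have "\<phi> ` ?\<psi> ` y \<in> (`) \<phi> ` ((intersecting G)\<^sup>* `` {x})" by (rule imageI)
    then show "y \<in> (`) \<phi> ` ((intersecting G)\<^sup>* `` {x})"
      unfolding vertex_iso_image_inv[OF \<phi> yH] .
  qed (use vertex_iso_intersecting[OF \<phi>] in auto)
  have cells_H: "cells H = (`) \<phi> ` cells G"
  proof (intro equalityI subsetI)
    fix y assume y: "y \<in> cells H"
    then have "\<phi> ` ?\<psi> ` y \<in> (`) \<phi> ` cells G"
      using vertex_iso_image_cell[OF \<psi>] by (intro imageI)
    then show "y \<in> (`) \<phi> ` cells G" unfolding vertex_iso_image_inv[OF \<phi> y] .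
  qed (use vertex_iso_image_cell[OF \<phi>] in blast)
  have "conn_components H = (\<lambda>x. (intersecting H)\<^sup>* `` {\<phi> ` x}) ` cells G"
    unfolding conn_components_image cells_H by (simp add: image_image)
  also have "\<dots> = (\<lambda>x. (`) \<phi> ` ((intersecting G)\<^sup>* `` {x})) ` cells G"
    by (rule image_cong) (simp_all add: comp)
  also have "\<dots> = (`) ((`) \<phi>) ` conn_components G"
    unfolding conn_components_image by (simp add: image_image)
  finally have components_H: "conn_components H = (`) ((`) \<phi>) ` conn_components G" .
  have inj_cells: "inj_on ((`) \<phi>) (cells G)" by (rule inj_onI) (simp add: inj_im)
  have "inj_on ((`) ((`) \<phi>)) (conn_components G)"
  proof (rule inj_onI)
    fix C D assume CD: "C \<in> conn_components G" "D \<in> conn_components G" "(`) \<phi> ` C = (`) \<phi> ` D"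
    then show "C = D"
      using inj_on_image_eq_iff[OF inj_cells component_subset component_subset] by blast
  qed
  moreover have "component_monomial ((`) \<phi> ` C) = component_monomial C"
    if C: "C \<in> conn_components G" for C
  proof -
    obtain K where K: "cells K = C" using component_exists[OF C] by blast
    have "(`) \<phi> ` C \<in> conn_components H" using C by (simp add: components_H)
    then obtain L where L: "cells L = (`) \<phi> ` C" using component_exists by blast
    have conn: "connected_complex K" "cells K \<noteq> {}" "connected_complex L" "cells L \<noteq> {}"
      using component_connected[of K G] component_connected[of L H] C K L
      by (auto simp: components_H)
    have "complex_iso K L"
      unfolding complex_iso_def K L
    proof (intro exI conjI ballI)
      show "bij_betw ((`) \<phi>) C ((`) \<phi> ` C)"
        using inj_on_subset[OF inj_cells component_subset[OF C]] by (simp add: bij_betw_def)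
      show "\<phi> ` x \<subseteq> \<phi> ` y \<longleftrightarrow> x \<subseteq> y" if "x \<in> C" "y \<in> C" for x y
        by (rule le_im) (use that component_subset[OF C] in blast)+
    qed
    then have "simplicial_factors K = simplicial_factors L"
      using simplicial_factors_iso conn by blast
    then show ?thesis using component_monomial_cells conn K L by metis
  qed
  ultimately show ?thesis
    by (simp add: complex_expansion_def components_H sum.reindex)
qed

definition signed_expansion :: "'v signed_complex \<Rightarrow> 'v strong_ring multiset \<Rightarrow>\<^sub>0 int" where
  "signed_expansion X = (\<Sum>(s, G)\<in>#X. of_int (int_of_sign s) * complex_expansion G)"

lemma signed_expansion_simps [simp]:
  "signed_expansion {#} = 0"
  "signed_expansion (X + Y) = signed_expansion X + signed_expansion Y"
  "signed_expansion (add_mset (s, G) X) = of_int (int_of_sign s) * complex_expansion G + signed_expansion X"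
  by (simp_all add: signed_expansion_def)

lemma signed_expansion_uminus: "signed_expansion (sc_uminus X) = - signed_expansion X"
  by (induction X) (auto simp: uminus_sign.rep_eq)

lemma signed_expansion_cong: "sc_equiv X Y \<Longrightarrow> signed_expansion X = signed_expansion Y"
proof (induction rule: sc_equiv.induct)
  case (iso G H s)
  then show ?case by (simp add: complex_expansion_iso)
next
  case (split Hs G s)
  have "signed_expansion (image_mset (Pair s) Hs) = of_int (int_of_sign s) * (\<Sum>H\<in>#Hs. complex_expansion H)"
    by (induction Hs) (simp_all add: distrib_left)
  with split show ?case by (simp add: complex_expansion_split)
qed (simp_all add: signed_expansion_uminus)

text \<open>
  This embeds the strong ring into the polynomial ring with one variable for each ring element;
  a connected product complex becomes the monomial of its factors.
\<close>

lift_definition expansion :: "'v strong_ring \<Rightarrow> ('v strong_ring multiset \<Rightarrow>\<^sub>0 int)"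
  is signed_expansion
  by (rule signed_expansion_cong)

lemma expansion_0 [simp]: "expansion 0 = 0"
  by transfer simp

lemma expansion_add [simp]: "expansion (a + b) = expansion a + expansion b"
  by transfer simp

lemma expansion_uminus [simp]: "expansion (- a) = - expansion a"
  by transfer (rule signed_expansion_uminus)

lemma expansion_complex_class: "expansion (complex_class G) = complex_expansion G"
  by transfer (simp add: one_sign.rep_eq)

lemma expansion_connected:
  "connected_complex G \<Longrightarrow> cells G \<noteq> {} \<Longrightarrow>
    expansion (complex_class G) = Poly_Mapping.single (simplicial_factors G) 1"
  by (simp add: expansion_complex_class complex_expansion_connected)

lemma sign_cases: "s = 1 \<or> s = (- 1 :: sign)"
  by transfer auto

text \<open>
  Splitting every summand into components shows that the classes of non-empty connected product
  complexes generate the additive group.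
\<close>

lemma strong_ring_induct [case_names zero add uminus connected]:
  assumes zero: "P 0" and add: "\<And>a b. P a \<Longrightarrow> P b \<Longrightarrow> P (a + b)" and uminus: "\<And>a. P a \<Longrightarrow> P (- a)"
    and conn: "\<And>G. connected_complex G \<Longrightarrow> cells G \<noteq> {} \<Longrightarrow> P (complex_class G)"
  shows "P x"
proof -
  have complex: "P (complex_class G)" for G
  proof -
    obtain Hs where Hs: "image_mset cells Hs = mset_set (conn_components G)"
      using split_exists by blast
    have "complex_class G = abs_strong_ring (image_mset (Pair 1) Hs)"
      unfolding complex_class.abs_eq strong_ring.abs_eq_iff by (rule sc_equiv.split[OF Hs])
    moreover have "P (abs_strong_ring (image_mset (Pair 1) Ks))"
      if "\<And>H. H \<in># Ks \<Longrightarrow> cells H \<in> conn_components G" for Ks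
      using that
    proof (induction Ks)
      case empty
      then show ?case using zero by (simp add: zero_strong_ring_def)
    next
      case (add K Ks)
      have "abs_strong_ring (image_mset (Pair 1) (add_mset K Ks)) =
          complex_class K + abs_strong_ring (image_mset (Pair 1) Ks)"
        by (simp add: complex_class.abs_eq plus_strong_ring.abs_eq)
      moreover have "P (complex_class K)"
        by (rule conn) (use component_connected[of K G] add(2) in simp_all)
      ultimately show ?case using assms(2) add by simp
    qed
    moreover have "cells H \<in> conn_components G" if "H \<in># Hs" for H
    proof -
      have "cells H \<in># mset_set (conn_components G)" unfolding Hs[symmetric] using that by simp
      then show ?thesis by simp
    qed
    ultimately show ?thesis by simp
  qed
  have "P (abs_strong_ring X)" for X
  proof (induction X)
    case empty
    then show ?case using zero by (simp add: zero_strong_ring_def)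
  next
    case (add p X)
    obtain s G where p: "p = (s, G)" by fastforce
    have "abs_strong_ring {#(- 1, G)#} = - complex_class G"
      by (simp add: complex_class.abs_eq uminus_strong_ring.abs_eq)
    then have "P (abs_strong_ring {#p#})"
      using sign_cases[of s] complex[of G] uminus by (auto simp: p complex_class.abs_eq)
    moreover have "abs_strong_ring (add_mset p X) = abs_strong_ring {#p#} + abs_strong_ring X"
      by (simp add: plus_strong_ring.abs_eq)
    ultimately show ?case using assms(2) add by simp
  qed
  then show ?thesis by (rule strong_ring.abs_induct)
qed

lemma connected_times:
  assumes "connected_complex G" "connected_complex H"
  shows "connected_complex (complex_times G H)"
  unfolding connected_complex_def
proof (intro ballI)
  fix p q assume "p \<in> cells (complex_times G H)" "q \<in> cells (complex_times G H)"
  then obtain x y x' y' where p: "p = cell_times x y" "x \<in> cells G" "y \<in> cells H"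
    and q: "q = cell_times x' y'" "x' \<in> cells G" "y' \<in> cells H"
    unfolding cells_times by auto
  have "(x, x') \<in> (intersecting G)\<^sup>*" "(y, y') \<in> (intersecting H)\<^sup>*"
    using assms p(2,3) q(2,3) by (simp_all add: connected_complex_def)
  then show "(p, q) \<in> (intersecting (complex_times G H))\<^sup>*"
    unfolding p(1) rtrancl_intersecting_times[OF p(2,3)] using q(1) by blast
qed

lemma expansion_mult [simp]: "expansion (a * b) = expansion a * expansion b"
proof (induction a rule: strong_ring_induct)
  case (connected G)
  show ?case
  proof (induction b rule: strong_ring_induct)
    case (connected H)
    have "cells (complex_times G H) \<noteq> {}"
      using \<open>cells G \<noteq> {}\<close> \<open>cells H \<noteq> {}\<close> by (simp add: cells_times)
    then show ?case
      using connected \<open>connected_complex G\<close> \<open>cells G \<noteq> {}\<close>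
      by (simp add: complex_class_times[symmetric] expansion_connected connected_times
          simplicial_factors_times mult_single)
  qed (simp_all add: distrib_left)
qed (simp_all add: distrib_right)

text \<open>
  So the expansion is injective, and a ring element whose expansion is a single term is an integer
  multiple of a product of classes.
\<close>

lemma evaluate_expansion: "evaluate (expansion a) = a"
proof (induction a rule: strong_ring_induct)
  case (connected G)
  have "evaluate (expansion (complex_class G)) = prod_mset (simplicial_factors G)"
    unfolding expansion_connected[OF connected] by (simp add: evaluate_single)
  then show ?case using complex_class_factorization[OF connected] by simp
qed (simp_all add: evaluate_0 evaluate_add evaluate_uminus)

lemma expansion_generator:
  assumes "x \<in> generators" shows "expansion x = Poly_Mapping.single {#x#} 1"
proof -
  obtain S where S: "x = simplex_class S" "connected_complex (of_simplicial_complex S)" "nontrivial S"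
    using assms by (auto simp: generators_def)
  have "cells (of_simplicial_complex S) \<noteq> {}"
    using S(3) by (auto simp: nontrivial_def cells_of_simplicial_complex)
  with S expansion_connected[of "of_simplicial_complex S"] show ?thesis
    by (simp add: simplex_class_def simplicial_factors_def)
qed

lemma expansion_1 [simp]: "expansion 1 = 1"
proof -
  have "connected_complex K1" by (simp add: connected_complex_def cells_K1)
  then have "expansion 1 = Poly_Mapping.single (simplicial_factors K1) 1"
    using expansion_connected[of K1] by (simp add: complex_class_K1 cells_K1)
  also have "simplicial_factors K1 = 0"
    by (simp add: simplicial_factors_def K1_def nontrivial_def simplices_one_point)
  finally show ?thesis by simp
qed


section \<open>Primes of the strong ring\<close>

text \<open>
  Every factorization of a signed monomial in the ring is a factorization into signed monomials.
\<close>

lemma factor_of_signed_monomial: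
  assumes ab: "expansion (a * b) = Poly_Mapping.single m c" and c: "\<bar>c\<bar> = 1"
  obtains m1 c1 m2 c2 where "m = m1 + m2" "c = c1 * c2" "\<bar>c1\<bar> = 1" "\<bar>c2\<bar> = 1"
    "a = of_int c1 * prod_mset m1" "b = of_int c2 * prod_mset m2"
    "expansion a = Poly_Mapping.single m1 c1" "expansion b = Poly_Mapping.single m2 c2"
proof -
  have "c \<noteq> 0" using c by auto
  with ab obtain m1 c1 m2 c2 where *: "expansion a = Poly_Mapping.single m1 c1"
    "expansion b = Poly_Mapping.single m2 c2" "m = m1 + m2" "c = c1 * c2"
    unfolding expansion_mult by (rule factors_of_single)
  have "\<bar>c1\<bar> = 1 \<and> \<bar>c2\<bar> = 1" using c *(4) by (metis abs_mult abs_zmult_eq_1 mult.commute)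
  moreover have "a = of_int c1 * prod_mset m1" "b = of_int c2 * prod_mset m2"
    using evaluate_expansion[of a] evaluate_expansion[of b] by (simp_all add: * evaluate_single)
  ultimately show thesis using that * by blast
qed

lemma expansion_prod_generators:
  "set_mset m \<subseteq> generators \<Longrightarrow> expansion (prod_mset m) = Poly_Mapping.single m 1"
  by (induction m) (simp_all add: expansion_generator mult_single)

lemma generator_not_unit:
  assumes "x \<in> generators" shows "x \<noteq> 0" "x \<noteq> 1" "x \<noteq> - 1"
proof -
  have x: "expansion x = Poly_Mapping.single {#x#} 1" by (rule expansion_generator[OF assms])
  have l: "Poly_Mapping.lookup (expansion x) {#x#} = 1" by (simp add: x)
  show "x \<noteq> 0" "x \<noteq> 1" "x \<noteq> - 1"
    using l by (auto simp: lookup_one when_def)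
qed

lemma generator_prime:
  assumes x: "x \<in> generators" shows "multiplicative_prime x"
  unfolding multiplicative_prime_def
proof (intro conjI generator_not_unit[OF x], rule notI)
  assume "\<exists>a b. x = a * b \<and> a \<noteq> 1 \<and> a \<noteq> - 1 \<and> b \<noteq> 1 \<and> b \<noteq> - 1"
  then obtain a b where ab: "x = a * b" "a \<noteq> 1" "a \<noteq> - 1" "b \<noteq> 1" "b \<noteq> - 1" by blast
  have "expansion (a * b) = Poly_Mapping.single {#x#} 1"
    using expansion_generator[OF x] ab(1) by simp
  then obtain m1 c1 m2 c2 where m: "{#x#} = m1 + m2" "\<bar>c1\<bar> = 1" "\<bar>c2\<bar> = (1::int)"
    "a = of_int c1 * prod_mset m1" "b = of_int c2 * prod_mset m2"
    by (rule factor_of_signed_monomial) simp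
  have "m1 = {#} \<or> m2 = {#}" using m(1) by (auto simp: single_is_union)
  moreover have "c1 = 1 \<or> c1 = - 1" "c2 = 1 \<or> c2 = - 1" using m(2,3) by linarith+
  ultimately show False using m(4,5) ab(2-5) by auto
qed

text \<open>
  A divisor of a monomial is a signed monomial. If it is prime, it cannot be a sign, so it
  contains a generator; splitting this off leaves a cofactor \<open>1\<close> or \<open>- 1\<close>.
\<close>

lemma prime_divisor_generator:
  assumes p: "multiplicative_prime p" and pb: "p * b = prod_mset m" and m: "set_mset m \<subseteq> generators"
  shows "\<exists>x\<in>generators. p = x \<or> p = - x"
proof -
  have "expansion (p * b) = Poly_Mapping.single m 1" unfolding pb by (rule expansion_prod_generators[OF m])
  then obtain m1 c1 m2 c2 where *: "m = m1 + m2" "\<bar>c1\<bar> = (1::int)" "p = of_int c1 * prod_mset m1"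
    by (rule factor_of_signed_monomial) simp
  have c1: "c1 = 1 \<or> c1 = - 1" using *(2) by linarith
  have "m1 \<noteq> {#}" using * c1 p by (auto simp: multiplicative_prime_def)
  then obtain x m' where x: "m1 = add_mset x m'" by (meson multiset_cases)
  have xg: "x \<in> generators" using * x m by auto
  have "p = x * (of_int c1 * prod_mset m')" using * x by simp
  with p generator_not_unit[OF xg] have "of_int c1 * prod_mset m' = 1 \<or> of_int c1 * prod_mset m' = - 1"
    unfolding multiplicative_prime_def by blast
  with \<open>p = x * _\<close> xg show ?thesis by auto
qed

text \<open>
  Each prime factor is a generator up to sign. Replacing the factors by these generators changes the
  product only by a sign, and comparing expansions identifies the resulting multiset with \<open>m\<close>.
\<close>

lemma prime_factorization_generators:
  assumes ps: "\<forall>p\<in>#ps. multiplicative_prime p" and eq: "prod_mset ps = prod_mset m"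
    and m: "set_mset m \<subseteq> generators"
  shows "rel_mset (\<lambda>p x. p = x \<or> p = - x) ps m"
proof -
  have "\<exists>x\<in>generators. p = x \<or> p = - x" if p: "p \<in># ps" for p
  proof -
    obtain ps' where "ps = add_mset p ps'" using multi_member_split[OF p] by blast
    then have "p * prod_mset ps' = prod_mset m" using eq by simp
    then show ?thesis using prime_divisor_generator[OF _ _ m] p ps by blast
  qed
  then have "\<forall>p. \<exists>x. p \<in># ps \<longrightarrow> x \<in> generators \<and> (p = x \<or> p = - x)" by blast
  then obtain g where g: "\<And>p. p \<in># ps \<Longrightarrow> g p \<in> generators \<and> (p = g p \<or> p = - g p)" by metis
  have "prod_mset qs = prod_mset (image_mset g qs) \<or> prod_mset qs = - prod_mset (image_mset g qs)"
    if "set_mset qs \<subseteq> set_mset ps" for qs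
    using that
  proof (induction qs)
    case (add q qs)
    let ?r = "prod_mset (image_mset g qs)"
    have "q * ?r = g q * ?r \<or> q * ?r = - (g q * ?r)"
      using g[of q] add(2) by (metis add_mset_add_single insert_subset minus_mult_left set_mset_add_mset_insert)
    with add show ?case by auto
  qed simp
  from this[of ps] have "expansion (prod_mset m) = Poly_Mapping.single (image_mset g ps) 1 \<or>
      expansion (prod_mset m) = - Poly_Mapping.single (image_mset g ps) 1"
    using expansion_prod_generators[of "image_mset g ps"] g unfolding eq by fastforce
  then have "Poly_Mapping.lookup (Poly_Mapping.single m (1::int)) (image_mset g ps) \<noteq> 0"
    unfolding expansion_prod_generators[OF m]
    by (elim disjE; simp only: lookup_single_eq lookup_uminus)
  then have gm: "image_mset g ps = m" by (simp add: lookup_single when_def split: if_splits)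
  have "rel_mset (\<lambda>p x. p = x \<or> p = - x) qs (image_mset g qs)" if "set_mset qs \<subseteq> set_mset ps" for qs
    using that
  proof (induction qs)
    case (add q qs)
    then show ?case using g[of q] by (auto intro!: rel_mset_Plus)
  qed (simp add: rel_mset_Zero)
  from this[of ps] gm show ?thesis by simp
qed

theorem corollary3:
  fixes G :: "'v::infinite product_complex"
  assumes "connected_complex G" and "cells G \<noteq> {}"
  shows
    "(\<exists>ps. (\<forall>p\<in>#ps. multiplicative_prime p) \<and> complex_class G = prod_mset ps) \<and>
     (\<forall>ps qs. (\<forall>p\<in>#ps. multiplicative_prime p) \<and> complex_class G = prod_mset ps \<and>
              (\<forall>q\<in>#qs. multiplicative_prime q) \<and> complex_class G = prod_mset qs \<longrightarrow>
        rel_mset (\<lambda>p q. p = q \<or> p = - q) ps qs) \<and>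
     (\<not> complex_iso G K1 \<longrightarrow>
        (multiplicative_prime (complex_class G) \<longleftrightarrow>
         (\<exists>S. connected_complex (of_simplicial_complex S) \<and>
              complex_class G = complex_class (of_simplicial_complex S))))"
proof (intro conjI allI impI)
  let ?m = "simplicial_factors G"
  have m: "complex_class G = prod_mset ?m" "set_mset ?m \<subseteq> generators"
    using complex_class_factorization[OF assms] by simp_all
  show "\<exists>ps. (\<forall>p\<in>#ps. multiplicative_prime p) \<and> complex_class G = prod_mset ps"
    using m generator_prime by blast
  show "rel_mset (\<lambda>p q. p = q \<or> p = - q) ps qs"
    if "(\<forall>p\<in>#ps. multiplicative_prime p) \<and> complex_class G = prod_mset ps \<and>
      (\<forall>q\<in>#qs. multiplicative_prime q) \<and> complex_class G = prod_mset qs" for ps qs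
  proof -
    let ?R = "\<lambda>p x :: 'v strong_ring. p = x \<or> p = - x"
    have "rel_mset ?R ps ?m" "rel_mset ?R qs ?m"
      using that m by (auto intro: prime_factorization_generators)
    then have "rel_mset (?R OO ?R\<inverse>\<inverse>) ps qs"
      by (auto simp: multiset.rel_compp multiset.rel_conversep)
    moreover have "?R OO ?R\<inverse>\<inverse> = ?R" by (auto simp: fun_eq_iff)
    ultimately show ?thesis by simp
  qed
  assume not_K1: "\<not> complex_iso G K1"
  show "multiplicative_prime (complex_class G) \<longleftrightarrow>
      (\<exists>S. connected_complex (of_simplicial_complex S) \<and>
        complex_class G = complex_class (of_simplicial_complex S))"
  proof
    assume prime: "multiplicative_prime (complex_class G)"
    have "rel_mset (\<lambda>p x. p = x \<or> p = - x) {#complex_class G#} ?m"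
      by (rule prime_factorization_generators) (use prime m in simp_all)
    then have "size ?m = 1" using rel_mset_size by fastforce
    then obtain x where "?m = {#x#}" using size_1_singleton_mset by blast
    then show "\<exists>S. connected_complex (of_simplicial_complex S) \<and>
        complex_class G = complex_class (of_simplicial_complex S)"
      using m by (auto simp: generators_def simplex_class_def)
  next
    assume "\<exists>S. connected_complex (of_simplicial_complex S) \<and>
        complex_class G = complex_class (of_simplicial_complex S)"
    then obtain S where S: "connected_complex (of_simplicial_complex S)" "complex_class G = simplex_class S"
      by (auto simp: simplex_class_def)
    have "simplex_class S \<noteq> 1" using not_K1 S(2) complex_class_eq_1_iff by metis
    moreover have "simplices S \<noteq> {}"
    proof
      assume "simplices S = {}"
      then have "expansion (complex_class G) = 0"
        unfolding S(2) simplex_class_def expansion_complex_class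
        by (simp add: complex_expansion_def conn_components_def quotient_def cells_of_simplicial_complex)
      then show False
        unfolding expansion_connected[OF assms] by (metis lookup_single_eq lookup_zero zero_neq_one)
    qed
    ultimately have "nontrivial S" using simplex_class_trivial by blast
    then have "complex_class G \<in> generators" using S by (auto simp: generators_def)
    then show "multiplicative_prime (complex_class G)" by (rule generator_prime)
  qed
qed

end
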